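(* Let $\mathcal L$ be a geometric lattice of rank $r\ge 1$ with a given linear order $\omega$ on its set of atoms. Then the maps $$\Psi:\mathbf{nbc}_\omega(\mathcal L)\to\mathbf{dc}_\omega(\mathcal L),\qquad \Psi(\{a_1,\dots,a_r\})=(\hat 0<a_r<a_r\vee a_{r-1}<\dots<a_r\vee a_{r-1}\vee\dots\vee a_1=\hat 1)$$ (where $a_1,\dots,a_r$ are in ascending order with respect to $\omega$), $$\Theta:\mathbf{dc}_\omega(\mathcal L)\to\mathbf{pn}_\omega(\mathcal L),\qquad \Theta(\hat 0<c_1<\dots<c_{r-1}<\hat 1)=F(c_1)\cup F(c_2)\cup\dots\cup F(c_{r-1})\cup F(\hat 1),$$ and $$\Phi:\mathbf{pn}_\omega(\mathcal L)\to\mathbf{nbc}_\omega(\mathcal L),\qquad \Phi(\mathcal S)=\{\phi(S)\mid S\in\mathcal S\},$$ give bijective correspondences between (1) the no broken circuit bases $\mathbf{nbc}_\omega(\mathcal L)$ of $\mathcal L$, (2) the maximal chains in $\mathcal L$ with decreasing label sequence, $\mathbf{dc}_\omega(\mathcal L)$, and (3) the proper maximal nested sets $\mathbf{pn}_\omega(\mathcal L)$ in $\widetilde{\mathcal N}(\mathcal L,\mathcal I)$, respectively.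
   Context: Let $\mathcal L$ be a (finite) geometric lattice of rank $r$ with minimum $\hat 0$, maximum $\hat 1$, set of atoms $\mathfrak A(\mathcal L)$, and a linear order $\omega$ on $\mathfrak A(\mathcal L)$; minima of sets of atoms are taken with respect to $\omega$. Independent sets, circuits (minimal dependent sets) and bases (maximal independent sets) of $\mathcal L$ are those of the associated simple matroid on $\mathfrak A(\mathcal L)$: a set of atoms is independent iff the rank of its join equals its cardinality. **No broken circuit bases.** A broken circuit is a set of atoms of the form $C\setminus\{\min C\}$ with $C$ a circuit. $\mathbf{nbc}_\omega(\mathcal L)$ is the set of bases of $\mathcal L$ that contain no broken circuit. **Decreasing chains.** For $X\in\mathcal L$ let $\lfloor X\rfloor=\{A\in\mathfrak A(\mathcal L)\mid A\le X\}$. Label a cover relation $X>Y$ in $\mathcal L$ by $\lambda(X>Y)=\min(\lfloor X\rfloor\setminus\lfloor Y\rfloor)$. $\mathbf{dc}_\omega(\mathcal L)$ is the set of maximal chains $\hat 0<c_1<\dots<c_{r-1}<\hat 1$ with strictly decreasing labels: $\lambda(c_1>\hat 0)>\lambda(c_2>c_1)>\dots>\lambda(\hat 1>c_{r-1})$. **Minimal building set, factors, nested sets.** The set $\mathcal I$ of irreducible elements of $\mathcal L$ consists of those $X\in\mathcal L$, $X>\hat 0$, for which the interval $[\hat 0,X]$ has no (nontrivial) product decomposition. For $X>\hat 0$, the set of factors of $X$ with respect to $\mathcal I$ is $F(X)=\max\{G\in\mathcal I\mid G\le X\}$ (the set of maximal elements). A subset $\mathcal S\subseteq\mathcal I$ is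 nested if for any set of at least two pairwise incomparable elements $X_1,\dots,X_t\in\mathcal S$ the join $X_1\vee\dots\vee X_t$ is not in $\mathcal I$. The nested sets form the (non-reduced) nested set complex $\widetilde{\mathcal N}(\mathcal L,\mathcal I)$. **Proper maximal nested sets.** Define $\phi:\mathcal I\to\mathfrak A(\mathcal L)$ by $\phi(S)=\min\lfloor S\rfloor$. A maximal nested set $\mathcal S$ (an inclusion-maximal simplex of $\widetilde{\mathcal N}(\mathcal L,\mathcal I)$) is proper if $\{\phi(S)\mid S\in\mathcal S\}$ is a basis of $\mathcal L$. $\mathbf{pn}_\omega(\mathcal L)$ is the set of proper maximal nested sets. *)

theory Defs
  imports Main
begin

definition (in order) covers :: "'a \<Rightarrow> 'a \<Rightarrow> bool" where
  "covers x y \<longleftrightarrow> y < x \<and> (\<nexists>z. y < z \<and> z < x)"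

definition (in order_bot) atoms :: "'a set" where
  "atoms = {a. covers a bot}"

text \<open>A finite nonempty lattice is complete, so a finite lattice with minimum and maximum is a
  finite type of class \<^class>\<open>complete_lattice\<close>.\<close>

class geometric_lattice = complete_lattice + finite +
  assumes atomistic: "x = Sup {a \<in> atoms. a \<le> x}"
    and upper_semimodular: "covers x (inf x y) \<Longrightarrow> covers (sup x y) y"

text \<open>The rank is the maximal length of a chain below \<open>x\<close>, where a chain with \<open>n + 1\<close> elements
  has length \<open>n\<close>.\<close>

definition rank :: "'a::geometric_lattice \<Rightarrow> nat" where
  "rank x = Max {card C - 1 | C. pred_on.chain {..x} (<) C}"

definition independent :: "'a::geometric_lattice set \<Rightarrow> bool" where
  "independent S \<longleftrightarrow> S \<subseteq> atoms \<and> rank (Sup S) = card S"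

definition circuit :: "'a::geometric_lattice set \<Rightarrow> bool" where
  "circuit C \<longleftrightarrow> C \<subseteq> atoms \<and> \<not> independent C \<and> (\<forall>D. D \<subset> C \<longrightarrow> independent D)"

definition basis :: "'a::geometric_lattice set \<Rightarrow> bool" where
  "basis B \<longleftrightarrow> independent B \<and> (\<forall>S. independent S \<and> B \<subseteq> S \<longrightarrow> S = B)"

text \<open>The order \<open>\<omega>\<close> is given by its reflexive relation, \<open>(a, b) \<in> \<omega>\<close> meaning \<open>a \<le> b\<close>.\<close>

definition min_wrt :: "'a rel \<Rightarrow> 'a set \<Rightarrow> 'a" where
  "min_wrt \<omega> S = (THE a. a \<in> S \<and> (\<forall>b\<in>S. (a, b) \<in> \<omega>))"

definition less_wrt :: "'a rel \<Rightarrow> 'a \<Rightarrow> 'a \<Rightarrow> bool" where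
  "less_wrt \<omega> a b \<longleftrightarrow> (a, b) \<in> \<omega> \<and> a \<noteq> b"

definition ascending_list :: "'a rel \<Rightarrow> 'a set \<Rightarrow> 'a list" where
  "ascending_list \<omega> S = (THE as. sorted_wrt (less_wrt \<omega>) as \<and> set as = S)"

definition broken_circuit :: "'a::geometric_lattice rel \<Rightarrow> 'a set \<Rightarrow> bool" where
  "broken_circuit \<omega> S \<longleftrightarrow> (\<exists>C. circuit C \<and> S = C - {min_wrt \<omega> C})"

definition nbc :: "'a::geometric_lattice rel \<Rightarrow> 'a set set" where
  "nbc \<omega> = {B. basis B \<and> \<not> (\<exists>S. broken_circuit \<omega> S \<and> S \<subseteq> B)}"

definition atoms_below :: "'a::geometric_lattice \<Rightarrow> 'a set" where
  "atoms_below x = {a \<in> atoms. a \<le> x}"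

definition label :: "'a::geometric_lattice rel \<Rightarrow> 'a \<Rightarrow> 'a \<Rightarrow> 'a" where
  "label \<omega> x y = min_wrt \<omega> (atoms_below x - atoms_below y)"

text \<open>A chain is the list of its elements from bottom to top, here
  \<open>[bot, c\<^sub>1, \<dots>, c\<^sub>r\<^sub>-\<^sub>1, top]\<close>, with label sequence
  \<open>[label \<omega> c\<^sub>1 bot, label \<omega> c\<^sub>2 c\<^sub>1, \<dots>, label \<omega> top c\<^sub>r\<^sub>-\<^sub>1]\<close>.\<close>

definition maximal_chain :: "'a::geometric_lattice list \<Rightarrow> bool" where
  "maximal_chain cs \<longleftrightarrow> sorted_wrt (<) cs \<and> pred_on.maxchain UNIV (<) (set cs)"

definition label_sequence :: "'a::geometric_lattice rel \<Rightarrow> 'a list \<Rightarrow> 'a list" where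
  "label_sequence \<omega> cs = map2 (label \<omega>) (tl cs) (butlast cs)"

definition dc :: "'a::geometric_lattice rel \<Rightarrow> 'a list set" where
  "dc \<omega> = {cs. maximal_chain cs \<and> sorted_wrt (\<lambda>a b. less_wrt \<omega> b a) (label_sequence \<omega> cs)}"

text \<open>Nontrivial product decomposition of a finite poset \<open>P\<close>. The factors \<open>A\<close> and \<open>B\<close> are arbitrary
  posets with at least two elements. Carrying them on the type of \<open>P\<close> is no restriction, since each
  factor embeds into the nonempty product.\<close>

definition product_decomposable :: "'a::{order,finite} set \<Rightarrow> bool" where
  "product_decomposable P \<longleftrightarrow>
    (\<exists>(A::'a set) (R::'a rel) (B::'a set) (S::'a rel) f.
      partial_order_on A R \<and> partial_order_on B S \<and> card A \<ge> 2 \<and> card B \<ge> 2 \<and>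
      bij_betw f P (A \<times> B) \<and>
      (\<forall>x\<in>P. \<forall>y\<in>P. x \<le> y \<longleftrightarrow> (fst (f x), fst (f y)) \<in> R \<and> (snd (f x), snd (f y)) \<in> S))"

definition irreducibles :: "'a::geometric_lattice set" where
  "irreducibles = {x. x > bot \<and> \<not> product_decomposable {bot..x}}"

definition factors :: "'a::geometric_lattice \<Rightarrow> 'a set" where
  "factors x = {g \<in> irreducibles. g \<le> x \<and> (\<forall>h\<in>irreducibles. h \<le> x \<and> g \<le> h \<longrightarrow> h = g)}"

definition nested :: "'a::geometric_lattice set \<Rightarrow> bool" where
  "nested S \<longleftrightarrow> S \<subseteq> irreducibles \<and>
    (\<forall>T\<subseteq>S. card T \<ge> 2 \<and> (\<forall>x\<in>T. \<forall>y\<in>T. x \<noteq> y \<longrightarrow> \<not> x \<le> y \<and> \<not> y \<le> x) \<longrightarrow>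
      Sup T \<notin> irreducibles)"

definition maximal_nested :: "'a::geometric_lattice set \<Rightarrow> bool" where
  "maximal_nested S \<longleftrightarrow> nested S \<and> (\<forall>T. nested T \<and> S \<subseteq> T \<longrightarrow> T = S)"

definition min_atom :: "'a::geometric_lattice rel \<Rightarrow> 'a \<Rightarrow> 'a" where
  "min_atom \<omega> s = min_wrt \<omega> (atoms_below s)"

definition pn :: "'a::geometric_lattice rel \<Rightarrow> 'a set set" where
  "pn \<omega> = {S. maximal_nested S \<and> basis (min_atom \<omega> ` S)}"

text \<open>For \<open>ascending_list \<omega> B = [a\<^sub>1, \<dots>, a\<^sub>r]\<close> this is the list
  \<open>[bot, a\<^sub>r, sup a\<^sub>r a\<^sub>r\<^sub>-\<^sub>1, \<dots>, Sup {a\<^sub>r, \<dots>, a\<^sub>1}]\<close>.\<close>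

definition Psi :: "'a::geometric_lattice rel \<Rightarrow> 'a set \<Rightarrow> 'a list" where
  "Psi \<omega> B =
    (let as = ascending_list \<omega> B
     in map (\<lambda>k. Sup (set (take k (rev as)))) [0..<Suc (length as)])"

text \<open>The tail drops the bottom element, so the union runs over \<open>c\<^sub>1, \<dots>, c\<^sub>r\<^sub>-\<^sub>1, top\<close>.\<close>

definition Theta :: "'a::geometric_lattice list \<Rightarrow> 'a set" where
  "Theta cs = (\<Union>c\<in>set (tl cs). factors c)"

definition Phi :: "'a::geometric_lattice rel \<Rightarrow> 'a set \<Rightarrow> 'a set" where
  "Phi \<omega> S = min_atom \<omega> ` S"

end

theory Submission
  imports Defs
begin

text \<open>
  Let \<open>b\<^sub>1 > \<dots> > b\<^sub>r\<close> be a basis in descending order and \<open>c\<^sub>k = b\<^sub>1 \<squnion> \<dots> \<squnion> b\<^sub>k\<close>. All three kinds of objects are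
  the same as bases with the property that every \<open>b\<^sub>k\<close> is the minimal atom below \<open>c\<^sub>k\<close> (\<open>flat_minimal\<close>).
  The basis contains no broken circuit if and only if it has this property, since a smaller atom below
  \<open>c\<^sub>k\<close> closes a circuit with \<open>b\<^sub>1, \<dots>, b\<^sub>k\<close> (\<open>nbc_iff_flat_minimal\<close>). If it has the property, then the
  chain of the \<open>c\<^sub>k\<close> has the labels \<open>b\<^sub>k\<close>, and each decreasing maximal chain arises in this way from
  its labels (\<open>joins_dc\<close>, \<open>dc_joins_label_sequence\<close>). So \<open>Psi\<close> is a bijection, and its inverse takes the
  set of labels.

  For the nested sets, the interval below \<open>x\<close> is the product of the intervals below the factors of \<open>x\<close>
  (\<open>inf_SUP_factors\<close>). Hence each step of a maximal chain produces exactly one new factor, and the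
  new factors form a maximal nested set (\<open>Theta_maximal_nested\<close>). If the chain is decreasing, the
  minimal atom below the new factor is the label of the step, so that \<open>Phi\<close> applied to \<open>Theta cs\<close> gives
  the set of labels of \<open>cs\<close> (\<open>Theta_pn\<close>).

  What remains is that each proper maximal nested set \<open>S\<close> comes from a decreasing chain. The rank of the
  join of a down-set of \<open>S\<close> is its cardinality (\<open>maximal_nested_rank\<close>). So \<open>S\<close> has as many elements as a
  basis, its members have distinct minimal atoms, and adding the members in descending order of these
  atoms gives a maximal chain, whose \<open>k\<close>-th element has all its factors in \<open>S\<close>. This chain is
  \<open>Psi \<omega> (Phi \<omega> S)\<close>; it is decreasing, and \<open>Theta\<close> maps it to \<open>S\<close> (\<open>pn_from_dc\<close>).
\<close>

section \<open>Rank\<close>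

lemma chain_less_iff:
  "pred_on.chain A ((<) :: 'a::order \<Rightarrow> _) C \<longleftrightarrow> C \<subseteq> A \<and> (\<forall>x\<in>C. \<forall>y\<in>C. x \<le> y \<or> y \<le> x)"
  unfolding pred_on.chain_def by (auto simp: less_le)

lemma atom_inf_eq_bot:
  assumes "a \<in> atoms" "\<not> a \<le> (y::'a::geometric_lattice)"
  shows "inf a y = bot"
proof (rule ccontr)
  assume "inf a y \<noteq> bot"
  then have "bot < inf a y" by (simp add: bot.not_eq_extremum)
  moreover have "inf a y < a" using assms(2) by (metis inf.cobounded1 inf.cobounded2 less_le)
  ultimately show False using assms(1) by (auto simp: atoms_def covers_def)
qed

lemma atom_gt_bot: "a \<in> atoms \<Longrightarrow> bot < (a::'a::geometric_lattice)"
  by (auto simp: atoms_def covers_def)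

lemma covers_sup_atom:
  assumes "a \<in> atoms" "\<not> a \<le> (y::'a::geometric_lattice)"
  shows "covers (sup y a) y"
proof -
  have "covers a (inf a y)" using assms atom_inf_eq_bot[OF assms] by (simp add: atoms_def)
  from upper_semimodular[OF this] show ?thesis by (simp add: sup.commute)
qed

lemma exists_atom_not_below:
  assumes "\<not> x \<le> (y::'a::geometric_lattice)"
  obtains a where "a \<in> atoms" "a \<le> x" "\<not> a \<le> y"
proof -
  have "\<exists>a\<in>atoms. a \<le> x \<and> \<not> a \<le> y"
  proof (rule ccontr)
    assume "\<not> ?thesis"
    then have "Sup {a \<in> atoms. a \<le> x} \<le> y" by (auto intro: Sup_least)
    with assms atomistic[of x] show False by simp
  qed
  with that show thesis by blast
qed

lemma covers_sup_eq:
  assumes "covers x (y::'a::geometric_lattice)" "a \<le> x" "\<not> a \<le> y"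
  shows "sup y a = x"
proof -
  have "y < sup y a" using assms(3) by (metis sup.cobounded1 sup.cobounded2 less_le)
  moreover have "sup y a \<le> x" using assms by (auto simp: covers_def)
  ultimately show ?thesis using assms(1) unfolding covers_def by (metis less_le)
qed

text \<open>The exchange argument behind the rank function. Joining a chain of \<open>[y, y \<squnion> \<Squnion>(insert a A)]\<close> with
  \<open>a\<close> gives a chain of \<open>[y \<squnion> a, y \<squnion> a \<squnion> \<Squnion>A]\<close>, to which the induction hypothesis applies, and
  loses at most one element, because \<open>y' \<squnion> a\<close> covers every \<open>y'\<close> that is not above \<open>a\<close>.\<close>

lemma chain_card_le:
  fixes C A :: "'a::geometric_lattice set"
  assumes "A \<subseteq> atoms" "pred_on.chain {y..sup y (Sup A)} (<) C"
  shows "card C \<le> Suc (card A)"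
proof -
  have "finite A" by simp
  then show ?thesis using assms
  proof (induction A arbitrary: y C rule: finite_induct)
    case empty
    then have "C \<subseteq> {y}" by (auto simp: chain_less_iff)
    then show ?case using card_mono[of "{y}" C] by simp
  next
    case (insert a A)
    have a: "a \<in> atoms" using insert.prems by simp
    have C: "C \<subseteq> {y..sup y (sup a (Sup A))}" "\<And>u v. u \<in> C \<Longrightarrow> v \<in> C \<Longrightarrow> u \<le> v \<or> v \<le> u"
      using insert.prems(2) by (auto simp: chain_less_iff)
    define f where "f z = sup z a" for z
    have "pred_on.chain {f y..sup (f y) (Sup A)} (<) (f ` C)"
      unfolding chain_less_iff
    proof (intro conjI ballI)
      show "f ` C \<subseteq> {f y..sup (f y) (Sup A)}"
        using C(1) by (force simp: f_def sup.assoc le_supI1 le_supI2 intro: sup_mono)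
      show "u \<le> v \<or> v \<le> u" if uv: "u \<in> f ` C" "v \<in> f ` C" for u v
      proof -
        obtain z w where "z \<in> C" "w \<in> C" "u = f z" "v = f w" using uv by blast
        then show ?thesis using C(2)[of z w] sup_mono[of z w a a] sup_mono[of w z a a] by (auto simp: f_def)
      qed
    qed
    then have image: "card (f ` C) \<le> Suc (card A)"
      using insert.IH insert.prems(1) by simp
    define N where "N = {z \<in> C. \<not> a \<le> z}"
    \<comment> \<open>Two chain elements can only be identified by \<open>f\<close> if the smaller one is the last element of
      the chain that is not above \<open>a\<close>.\<close>
    have "\<exists>m. inj_on f (C - {m})"
    proof (cases "N = {}")
      case True
      then have "f z = z" if "z \<in> C" for z using that by (auto simp: N_def f_def sup.absorb1)
      then show ?thesis by (auto simp: inj_on_def)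
    next
      case False
      then obtain m where m: "m \<in> N" "\<And>z. z \<in> N \<Longrightarrow> m \<le> z \<Longrightarrow> m = z"
        using finite_has_maximal[of N] by auto
      have *: False if "u \<in> C - {m}" "v \<in> C - {m}" "f u = f v" "u < v" for u v
      proof (cases "a \<le> u")
        case True
        then have "f u = u" "f v = v" using that(4) by (auto simp: f_def sup.absorb1)
        with that show False by simp
      next
        case False
        have "u < m" using False m C(2)[of u m] that(1) by (auto simp: N_def less_le)
        have "v \<le> f u" using that(3) by (simp add: f_def)
        then have "v = f u" using covers_sup_atom[OF a False] that(4) by (auto simp: covers_def f_def less_le)
        then have "a \<le> v" by (simp add: f_def)
        then have "m < v" using m(1) C(2)[of m v] that(2) by (auto simp: N_def less_le)
        with \<open>u < m\<close> \<open>v = f u\<close> covers_sup_atom[OF a False] show False by (auto simp: covers_def f_def)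
      qed
      have "inj_on f (C - {m})"
      proof (rule inj_onI)
        fix u v assume "u \<in> C - {m}" "v \<in> C - {m}" "f u = f v"
        then show "u = v" using *[of u v] *[of v u] C(2)[of u v] by (auto simp: less_le)
      qed
      then show ?thesis by blast
    qed
    then obtain m where "inj_on f (C - {m})" by blast
    then have "card (C - {m}) = card (f ` (C - {m}))" by (simp add: card_image)
    also have "\<dots> \<le> card (f ` C)" by (rule card_mono) auto
    finally have "card (C - {m}) \<le> Suc (card A)" using image by simp
    moreover have "card C \<le> Suc (card (C - {m}))"
      by (simp add: card_Diff_singleton_if) arith
    ultimately show ?case using insert.hyps by simp
  qed
qed

lemma rank_ge_chain:
  assumes "pred_on.chain {..x::'a::geometric_lattice} (<) C"
  shows "card C - 1 \<le> rank x"
  unfolding rank_def using assms by (auto intro: Max_ge)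

lemma rank_chain_exists:
  obtains C where "pred_on.chain {..x::'a::geometric_lattice} (<) C" "rank x = card C - 1"
proof -
  have "rank x \<in> {card C - 1 | C. pred_on.chain {..x} (<) C}"
    unfolding rank_def by (rule Max_in) (auto intro: exI[of _ "{}"] simp: chain_less_iff)
  with that show thesis by auto
qed

lemma rank_Sup_le_card:
  assumes "A \<subseteq> atoms"
  shows "rank (Sup A :: 'a::geometric_lattice) \<le> card A"
proof -
  obtain C where "pred_on.chain {..Sup A} (<) C" "rank (Sup A) = card C - 1"
    by (rule rank_chain_exists)
  moreover then have "pred_on.chain {bot..sup bot (Sup A)} (<) C"
    by (auto simp: chain_less_iff)
  ultimately show ?thesis using chain_card_le[OF assms] by fastforce
qed

lemma rank_strict_mono:
  assumes "x < (y::'a::geometric_lattice)"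
  shows "rank x < rank y"
proof -
  obtain C where C: "pred_on.chain {..x} (<) C" "rank x = card C - 1"
    by (rule rank_chain_exists)
  \<comment> \<open>The empty set is a chain too; adding \<open>x\<close> makes sure that the chain is nonempty.\<close>
  have 1: "pred_on.chain {..x} (<) (insert x C)" using C(1) by (auto simp: chain_less_iff)
  have 2: "pred_on.chain {..y} (<) (insert y (insert x C))"
    using C(1) assms by (auto simp: chain_less_iff)
  have "y \<notin> insert x C" using C(1) assms by (auto simp: chain_less_iff)
  then have "card (insert y (insert x C)) = Suc (card (insert x C))" by simp
  moreover have "card (insert x C) > 0" by (simp add: card_gt_0_iff)
  moreover have "card C \<le> card (insert x C)" by (rule card_mono) auto
  ultimately show ?thesis using rank_ge_chain[OF 1] rank_ge_chain[OF 2] C(2) by simp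
qed

lemma rank_mono: "x \<le> y \<Longrightarrow> rank (x::'a::geometric_lattice) \<le> rank y"
  using rank_strict_mono[of x y] by (cases "x = y") (auto simp: less_le)

lemma rank_bot: "rank (bot::'a::geometric_lattice) = 0"
  using rank_Sup_le_card[of "{} :: 'a set"] by simp

lemma covers_exists:
  assumes "z < (x::'a::geometric_lattice)"
  obtains y where "covers x y" "z \<le> y"
proof -
  obtain y where y: "y \<in> {y. z \<le> y \<and> y < x}" "\<forall>w\<in>{y. z \<le> y \<and> y < x}. y \<le> w \<longrightarrow> y = w"
    using finite_has_maximal[of "{y. z \<le> y \<and> y < x}"] assms by auto
  then have "covers x y" unfolding covers_def by (simp) (metis order.trans less_imp_le less_irrefl)
  with y that show thesis by auto
qed

text \<open>Going up from \<open>bot\<close> along covers, each step needs one more atom and raises the rank by at least one.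
  As the rank is at most the number of atoms of any spanning set, both counts agree.\<close>

lemma spanning_atoms_exist:
  obtains A where "A \<subseteq> atoms" "Sup A = (x::'a::geometric_lattice)" "card A = rank x"
proof -
  have "\<exists>A\<subseteq>atoms. Sup A = x \<and> card A = rank x"
  proof (induction "rank x" arbitrary: x rule: less_induct)
    case less
    show ?case
    proof (cases "x = bot")
      case True
      then show ?thesis by (intro exI[of _ "{}"]) (simp add: rank_bot)
    next
      case False
      then obtain y where y: "covers x y" using covers_exists bot.not_eq_extremum by metis
      then have "y < x" by (simp add: covers_def)
      then have "rank y < rank x" by (rule rank_strict_mono)
      with less obtain A where A: "A \<subseteq> atoms" "Sup A = y" "card A = rank y" by blast
      obtain a where a: "a \<in> atoms" "a \<le> x" "\<not> a \<le> y"
        using exists_atom_not_below[of x y] less_le_not_le[of y x] \<open>y < x\<close> by blast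
      have x: "Sup (insert a A) = x" using covers_sup_eq[OF y a(2,3)] A by (simp add: sup.commute)
      have "rank x \<le> card (insert a A)" using rank_Sup_le_card[of "insert a A"] a A x by simp
      also have "\<dots> \<le> Suc (rank y)" using A(3) by (simp add: card_insert_if)
      finally have "card (insert a A) = rank x"
        using \<open>rank y < rank x\<close> \<open>card (insert a A) \<le> Suc (rank y)\<close> \<open>rank x \<le> card (insert a A)\<close> by linarith
      with a A x show ?thesis by blast
    qed
  qed
  with that show thesis by blast
qed

text \<open>The lattice is graded: a covered element \<open>y\<close> is spanned by \<open>rank y\<close> atoms, and one more atom spans
  the covering element.\<close>

lemma rank_covers:
  assumes "covers x (y::'a::geometric_lattice)"
  shows "rank x = Suc (rank y)"
proof -
  have "y < x" using assms by (simp add: covers_def)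
  obtain A where A: "A \<subseteq> atoms" "Sup A = y" "card A = rank y" by (rule spanning_atoms_exist)
  obtain a where a: "a \<in> atoms" "a \<le> x" "\<not> a \<le> y"
    using exists_atom_not_below[of x y] less_le_not_le[of y x] \<open>y < x\<close> by blast
  have "Sup (insert a A) = x" using covers_sup_eq[OF assms a(2,3)] A by (simp add: sup.commute)
  then have "rank x \<le> card (insert a A)" using rank_Sup_le_card[of "insert a A"] a A by simp
  also have "\<dots> \<le> Suc (rank y)" using A(3) by (simp add: card_insert_if)
  finally show ?thesis using rank_strict_mono[OF \<open>y < x\<close>] by simp
qed

lemma rank_sup_atom:
  assumes "a \<in> atoms"
  shows "rank (sup x a) = (if a \<le> x then rank x else Suc (rank (x::'a::geometric_lattice)))"
  using rank_covers[OF covers_sup_atom[OF assms, of x]] by (simp add: sup.absorb1)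

lemma eq_if_le_rank:
  assumes "x \<le> (y::'a::geometric_lattice)" "rank y \<le> rank x"
  shows "x = y"
  using assms rank_strict_mono[of x y] by (auto simp: less_le)

section \<open>Independent sets and bases\<close>

lemma independent_insert_iff:
  assumes "a \<notin> S"
  shows "independent (insert a S) \<longleftrightarrow> independent S \<and> a \<in> atoms \<and> \<not> a \<le> (Sup S :: 'a::geometric_lattice)"
proof (cases "insert a S \<subseteq> atoms")
  case True
  have "rank (Sup (insert a S)) = rank (sup (Sup S) a)" by (simp add: sup.commute)
  then show ?thesis
    using True assms rank_sup_atom[of a "Sup S"] rank_Sup_le_card[of S] by (auto simp: independent_def)
next
  case False
  then show ?thesis by (auto simp: independent_def)
qed

lemma independent_mono:
  fixes S T :: "'a::geometric_lattice set"
  assumes "independent T" "S \<subseteq> T"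
  shows "independent S"
proof -
  have "independent (S \<union> U) \<longrightarrow> independent S" if "finite U" for U
    using that
  proof (induction U)
    case (insert a U)
    then show ?case using independent_insert_iff[of a "S \<union> U"] by (cases "a \<in> S \<union> U") (auto simp: insert_absorb)
  qed simp
  from this[of "T"] show ?thesis using assms by (simp add: Un_absorb1)
qed

lemma basis_iff:
  "basis B \<longleftrightarrow> independent B \<and> Sup B = (top::'a::geometric_lattice)"
proof
  assume B: "basis B"
  show "independent B \<and> Sup B = top"
  proof (rule ccontr)
    assume "\<not> ?thesis"
    then have "\<not> top \<le> Sup B" using B by (auto simp: basis_def top_unique)
    then obtain a where "a \<in> atoms" "\<not> a \<le> Sup B" by (rule exists_atom_not_below)
    moreover then have "a \<notin> B" by (auto intro: Sup_upper)
    ultimately have "independent (insert a B)" using B independent_insert_iff[of a B] by (simp add: basis_def)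
    with B \<open>a \<notin> B\<close> show False by (auto simp: basis_def)
  qed
next
  assume B: "independent B \<and> Sup B = top"
  have "S = B" if "independent S" "B \<subseteq> S" for S
  proof -
    have "card S = card B"
      using that B Sup_subset_mono[OF that(2)] by (auto simp: independent_def top_unique)
    with that(2) show ?thesis using card_subset_eq[of S B] by simp
  qed
  with B show "basis B" by (auto simp: basis_def)
qed

lemma basis_card:
  fixes B :: "'a::geometric_lattice set"
  assumes "basis B"
  shows "card B = rank (top::'a::geometric_lattice)"
  using assms by (auto simp: basis_iff independent_def)

lemma contains_circuit:
  fixes S :: "'a::geometric_lattice set"
  assumes "S \<subseteq> atoms" "\<not> independent S"
  obtains C where "circuit C" "C \<subseteq> S"
proof -
  let ?D = "{C. C \<subseteq> S \<and> \<not> independent C}"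
  have "finite ?D" "?D \<noteq> {}" using assms(2) by auto
  then obtain C where C: "C \<in> ?D" "\<forall>D\<in>?D. D \<subseteq> C \<longrightarrow> C = D"
    using finite_has_minimal[of ?D] by meson
  then have "circuit C" using assms(1) unfolding circuit_def by auto
  with C that show thesis by blast
qed

lemma circuit_atom_le:
  assumes "circuit C" "a \<in> C"
  shows "a \<le> (Sup (C - {a}) :: 'a::geometric_lattice)"
proof -
  have "independent (C - {a})" "\<not> independent (insert a (C - {a}))" "a \<in> atoms"
    using assms by (auto simp: circuit_def insert_absorb)
  then show ?thesis using independent_insert_iff[of a "C - {a}"] by simp
qed

section \<open>Maximal chains\<close>

lemma covers_nth_sorted:
  fixes cs :: "'a::geometric_lattice list"
  assumes "\<And>i. Suc i < length cs \<Longrightarrow> covers (cs ! Suc i) (cs ! i)"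
  shows "sorted_wrt (<) cs"
  using assms by (auto simp: sorted_wrt_iff_nth_Suc_transp covers_def transp_def)

lemma covers_nth_rank:
  fixes cs :: "'a::geometric_lattice list"
  assumes "\<And>i. Suc i < length cs \<Longrightarrow> covers (cs ! Suc i) (cs ! i)" "cs ! 0 = bot" "i < length cs"
  shows "rank (cs ! i) = i"
  using assms(3)
proof (induction i)
  case (Suc i)
  then show ?case using rank_covers[OF assms(1)[of i]] by simp
qed (simp add: assms(2) rank_bot)

lemma maxchain_lessD:
  fixes C :: "'a::order set"
  assumes "pred_on.maxchain UNIV (<) C" "\<And>x. x \<in> C \<Longrightarrow> x \<le> z \<or> z \<le> x"
  shows "z \<in> C"
proof (rule ccontr)
  assume "z \<notin> C"
  moreover have "pred_on.chain UNIV (<) (insert z C)"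
    using assms by (auto simp: pred_on.maxchain_def chain_less_iff)
  ultimately show False using assms(1) by (auto simp: pred_on.maxchain_def)
qed

text \<open>In a graded lattice, the maximal chains are the sequences of covers that go through all ranks.\<close>

lemma maximal_chain_iff:
  fixes cs :: "'a::geometric_lattice list"
  shows "maximal_chain cs \<longleftrightarrow> length cs = Suc (rank (top::'a)) \<and> cs ! 0 = bot \<and>
    (\<forall>i<rank (top::'a). covers (cs ! Suc i) (cs ! i))" (is "?L \<longleftrightarrow> ?R")
proof
  assume ?L
  then have max: "pred_on.maxchain UNIV (<) (set cs)" and sorted: "sorted_wrt (<) cs"
    by (auto simp: maximal_chain_def)
  have nth_mono: "cs ! i \<le> cs ! j" if "i \<le> j" "j < length cs" for i j
    using that sorted_wrt_nth_less[OF sorted, of i j] by (cases "i = j") (auto simp: less_le)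
  have "bot \<in> set cs" "top \<in> set cs" by (auto intro: maxchain_lessD[OF max])
  then obtain i j where i: "i < length cs" "cs ! i = bot" and j: "j < length cs" "cs ! j = top"
    by (auto simp: in_set_conv_nth)
  have bot: "cs ! 0 = bot" using nth_mono[of 0 i] i by (simp add: bot_unique)
  have top: "cs ! (length cs - 1) = top" using nth_mono[of j "length cs - 1"] j by (simp add: top_unique)
  have cov: "covers (cs ! Suc k) (cs ! k)" if k: "Suc k < length cs" for k
  proof -
    have "False" if z: "cs ! k < z" "z < cs ! Suc k" for z
    proof -
      have "z \<in> set cs"
      proof (rule maxchain_lessD[OF max])
        fix x assume "x \<in> set cs"
        then obtain l where l: "l < length cs" "x = cs ! l" by (auto simp: in_set_conv_nth)
        then show "x \<le> z \<or> z \<le> x"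
          using z nth_mono[of l k] nth_mono[of "Suc k" l] k by (cases "l \<le> k") auto
      qed
      then obtain l where l: "l < length cs" "z = cs ! l" by (auto simp: in_set_conv_nth)
      then show False using z nth_mono[of l k] nth_mono[of "Suc k" l] k by (cases "l \<le> k") auto
    qed
    then show ?thesis using sorted_wrt_nth_less[OF sorted, of k "Suc k"] k by (auto simp: covers_def)
  qed
  have "length cs - 1 < length cs" using i by simp
  then have "rank (cs ! (length cs - 1)) = length cs - 1" by (intro covers_nth_rank cov bot)
  with top i have "length cs = Suc (rank (top::'a))" by simp
  with bot cov show ?R by simp
next
  assume R: ?R
  then have cov: "\<And>i. Suc i < length cs \<Longrightarrow> covers (cs ! Suc i) (cs ! i)" by simp
  have sorted: "sorted_wrt (<) cs" using cov by (rule covers_nth_sorted)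
  have nth_mono: "cs ! i \<le> cs ! j" if "i \<le> j" "j < length cs" for i j
    using that sorted_wrt_nth_less[OF sorted, of i j] by (cases "i = j") (auto simp: less_le)
  have "pred_on.maxchain UNIV (<) (set cs)"
    unfolding pred_on.maxchain_def
  proof (intro conjI notI)
    have "x \<le> y \<or> y \<le> x" if xy: "x \<in> set cs" "y \<in> set cs" for x y
    proof -
      obtain i j where "i < length cs" "x = cs ! i" "j < length cs" "y = cs ! j"
        using xy by (auto simp: in_set_conv_nth)
      then show ?thesis using nth_mono[of i j] nth_mono[of j i] by (cases "i \<le> j") auto
    qed
    then show "pred_on.chain UNIV (<) (set cs)" by (auto simp: chain_less_iff)
  next
    assume "\<exists>D. pred_on.chain UNIV (<) D \<and> set cs \<subset> D"
    then obtain D z where D: "pred_on.chain UNIV (<) D" "set cs \<subset> D" "z \<in> D" "z \<notin> set cs" by blast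
    \<comment> \<open>The chain already has an element of the rank of \<open>z\<close>, and comparable elements of the same
      rank are equal.\<close>
    have len: "rank z < length cs" using R rank_mono[of z top] by simp
    then have "rank (cs ! rank z) = rank z" using cov R by (intro covers_nth_rank) auto
    moreover have "cs ! rank z \<in> D" using D(2) nth_mem[OF len] by blast
    then have "z \<le> cs ! rank z \<or> cs ! rank z \<le> z" using D by (auto simp: chain_less_iff)
    ultimately have "z = cs ! rank z"
      using eq_if_le_rank[of z "cs ! rank z"] eq_if_le_rank[of "cs ! rank z" z] by auto
    with D(4) nth_mem[OF len] show False by simp
  qed
  with sorted show ?L by (simp add: maximal_chain_def)
qed

section \<open>Product decompositions and factors\<close>

text \<open>The decomposition \<open>[bot, x] \<cong> [bot, y] \<times> [bot, z]\<close> inside the lattice: \<open>w \<mapsto> (w \<sqinter> y, w \<sqinter> z)\<close> and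
  \<open>(u, v) \<mapsto> u \<squnion> v\<close> are mutually inverse. This form needs no external factor posets and is inherited by
  the elements below \<open>x\<close>.\<close>

definition splits :: "'a::lattice \<Rightarrow> 'a \<Rightarrow> 'a \<Rightarrow> bool" where
  "splits x y z \<longleftrightarrow> y \<le> x \<and> z \<le> x \<and>
    (\<forall>w\<le>x. w = sup (inf w y) (inf w z)) \<and>
    (\<forall>u\<le>y. \<forall>v\<le>z. inf (sup u v) y = u \<and> inf (sup u v) z = v)"

lemma splits_decomposable:
  fixes x y z :: "'a::{bounded_lattice_bot,finite}"
  assumes "splits x y z" "y \<noteq> bot" "z \<noteq> bot"
  shows "product_decomposable {bot..x}"
proof -
  define R where "R (t::'a) = {(u, v). u \<le> v \<and> v \<le> t}" for t
  define f where "f w = (inf w y, inf w z)" for w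
  have y: "y \<le> x" and z: "z \<le> x" and join: "\<And>w. w \<le> x \<Longrightarrow> w = sup (inf w y) (inf w z)"
    and meet: "\<And>u v. u \<le> y \<Longrightarrow> v \<le> z \<Longrightarrow> inf (sup u v) y = u" "\<And>u v. u \<le> y \<Longrightarrow> v \<le> z \<Longrightarrow> inf (sup u v) z = v"
    using assms(1) by (auto simp: splits_def)
  have order: "partial_order_on {bot..t} (R t)" for t
    by (auto simp: order_on_defs refl_on_def trans_def antisym_def R_def intro: order.trans)
  have card: "card {bot..t} \<ge> 2" if "t \<noteq> bot" for t :: 'a
    using card_mono[of "{bot..t}" "{bot, t}"] that by simp
  have "bij_betw f {bot..x} ({bot..y} \<times> {bot..z})"
  proof (rule bij_betw_byWitness[where f' = "\<lambda>(u, v). sup u v"])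
    show "\<forall>w\<in>{bot..x}. (case f w of (u, v) \<Rightarrow> sup u v) = w" using join by (auto simp: f_def)
    show "\<forall>p\<in>{bot..y} \<times> {bot..z}. f (case p of (u, v) \<Rightarrow> sup u v) = p" using meet by (auto simp: f_def)
    show "f ` {bot..x} \<subseteq> {bot..y} \<times> {bot..z}" by (auto simp: f_def)
    show "(\<lambda>(u, v). sup u v) ` ({bot..y} \<times> {bot..z}) \<subseteq> {bot..x}"
      using y z by (auto intro: order.trans)
  qed
  moreover have "v \<le> w \<longleftrightarrow> (fst (f v), fst (f w)) \<in> R y \<and> (snd (f v), snd (f w)) \<in> R z"
    if "v \<in> {bot..x}" "w \<in> {bot..x}" for v w
  proof
    show "(fst (f v), fst (f w)) \<in> R y \<and> (snd (f v), snd (f w)) \<in> R z" if "v \<le> w"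
      using that by (auto simp: f_def R_def intro: le_infI1)
    assume "(fst (f v), fst (f w)) \<in> R y \<and> (snd (f v), snd (f w)) \<in> R z"
    then have "inf v y \<le> w" "inf v z \<le> w" by (auto simp: f_def R_def)
    then show "v \<le> w" using join[of v] that by (metis atLeastAtMost_iff sup_least)
  qed
  ultimately show ?thesis
    unfolding product_decomposable_def using order[of y] order[of z] card[OF assms(2)] card[OF assms(3)]
    by (intro exI[of _ "{bot..y}"] exI[of _ "R y"] exI[of _ "{bot..z}"] exI[of _ "R z"] exI[of _ f]) simp
qed

text \<open>The bounds of \<open>[bot, x]\<close> give both factor posets a least and a greatest element. The two
  elements that are greatest in one coordinate and least in the other one are \<open>y\<close> and \<open>z\<close>.\<close>

lemma decomposable_splits:
  fixes x :: "'a::{bounded_lattice_bot,finite}"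
  assumes "product_decomposable {bot..x}"
  obtains y z where "splits x y z" "y \<noteq> bot" "z \<noteq> bot"
proof -
  obtain A B :: "'a set" and R S f where A: "partial_order_on A R" "card A \<ge> 2"
    and B: "partial_order_on B S" "card B \<ge> 2" and bij: "bij_betw f {bot..x} (A \<times> B)"
    and iff: "\<And>v w. v \<le> x \<Longrightarrow> w \<le> x \<Longrightarrow>
      v \<le> w \<longleftrightarrow> (fst (f v), fst (f w)) \<in> R \<and> (snd (f v), snd (f w)) \<in> S"
    using assms unfolding product_decomposable_def by auto
  define g where "g = the_inv_into {bot..x} f"
  have fg: "f (g (a, b)) = (a, b)" "g (a, b) \<le> x" if "a \<in> A" "b \<in> B" for a b
    using that bij f_the_inv_into_f_bij_betw[OF bij, of "(a, b)"]
      bij_betw_apply[OF bij_betw_the_inv_into[OF bij], of "(a, b)"] by (auto simp: g_def)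
  have gf: "g (f w) = w" "fst (f w) \<in> A" "snd (f w) \<in> B" if "w \<le> x" for w
    using that bij the_inv_into_f_f[of f "{bot..x}" w] bij_betw_apply[OF bij, of w]
    by (auto simp: g_def bij_betw_def mem_Times_iff)
  have g_le: "g (a, b) \<le> g (a', b') \<longleftrightarrow> (a, a') \<in> R \<and> (b, b') \<in> S"
    if "a \<in> A" "b \<in> B" "a' \<in> A" "b' \<in> B" for a b a' b'
    using iff[of "g (a, b)" "g (a', b')"] fg that by simp
  define a0 b0 a1 b1 where "a0 = fst (f bot)" and "b0 = snd (f bot)" and "a1 = fst (f x)" and "b1 = snd (f x)"
  have mem: "a0 \<in> A" "b0 \<in> B" "a1 \<in> A" "b1 \<in> B"
    using gf[of bot] gf[of x] by (auto simp: a0_def b0_def a1_def b1_def)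
  have refl: "\<And>a. a \<in> A \<Longrightarrow> (a, a) \<in> R" "\<And>b. b \<in> B \<Longrightarrow> (b, b) \<in> S"
    using A(1) B(1) by (auto simp: order_on_defs refl_on_def)
  have bounds: "(a0, a) \<in> R \<and> (a, a1) \<in> R" "(b0, b) \<in> S \<and> (b, b1) \<in> S"
    if "a \<in> A" "b \<in> B" for a b
    using iff[of bot "g (a, b)"] iff[of "g (a, b)" x] fg[OF that]
    by (auto simp: a0_def a1_def b0_def b1_def)
  have trans: "\<And>a b c. (a, b) \<in> R \<Longrightarrow> (b, c) \<in> R \<Longrightarrow> (a, c) \<in> R"
    "\<And>a b c. (a, b) \<in> S \<Longrightarrow> (b, c) \<in> S \<Longrightarrow> (a, c) \<in> S"
    "\<And>a b. (a, b) \<in> R \<Longrightarrow> (b, a) \<in> R \<Longrightarrow> a = b" "\<And>a b. (a, b) \<in> S \<Longrightarrow> (b, a) \<in> S \<Longrightarrow> a = b"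
    using A(1) B(1) by (auto simp: order_on_defs dest: transD antisymD)
  define y z where "y = g (a1, b0)" and "z = g (a0, b1)"
  have g_onto: "\<exists>a\<in>A. \<exists>b\<in>B. w = g (a, b)" if "w \<le> x" for w
    using gf[OF that] by (metis prod.collapse)
  have yz: "y \<le> x" "z \<le> x" using fg mem by (auto simp: y_def z_def)
  have inf_y: "inf (g (a, b)) y = g (a, b0)" if "a \<in> A" "b \<in> B" for a b
  proof (rule antisym)
    show "g (a, b0) \<le> inf (g (a, b)) y" using g_le that mem refl bounds by (auto simp: y_def)
    have "inf (g (a, b)) y \<le> x" using yz by (simp add: le_infI2)
    then obtain c d where cd: "c \<in> A" "d \<in> B" "inf (g (a, b)) y = g (c, d)" using g_onto by blast
    then have "g (c, d) \<le> g (a, b)" "g (c, d) \<le> g (a1, b0)" by (metis inf.cobounded1, metis inf.cobounded2 y_def)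
    then show "inf (g (a, b)) y \<le> g (a, b0)" using cd g_le that mem by simp
  qed
  have inf_z: "inf (g (a, b)) z = g (a0, b)" if "a \<in> A" "b \<in> B" for a b
  proof (rule antisym)
    show "g (a0, b) \<le> inf (g (a, b)) z" using g_le that mem refl bounds by (auto simp: z_def)
    have "inf (g (a, b)) z \<le> x" using yz by (simp add: le_infI2)
    then obtain c d where cd: "c \<in> A" "d \<in> B" "inf (g (a, b)) z = g (c, d)" using g_onto by blast
    then have "g (c, d) \<le> g (a, b)" "g (c, d) \<le> g (a0, b1)" by (metis inf.cobounded1, metis inf.cobounded2 z_def)
    then show "inf (g (a, b)) z \<le> g (a0, b)" using cd g_le that mem by simp
  qed
  have sup_g: "sup (g (a, b0)) (g (a0, b)) = g (a, b)" if "a \<in> A" "b \<in> B" for a b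
  proof (rule antisym)
    show "sup (g (a, b0)) (g (a0, b)) \<le> g (a, b)" using g_le that mem refl bounds by auto
    have "sup (g (a, b0)) (g (a0, b)) \<le> x" using fg that mem by simp
    then obtain c d where cd: "c \<in> A" "d \<in> B" "sup (g (a, b0)) (g (a0, b)) = g (c, d)" using g_onto by blast
    then have "g (a, b0) \<le> g (c, d)" "g (a0, b) \<le> g (c, d)" by (metis sup.cobounded1, metis sup.cobounded2)
    then show "g (a, b) \<le> sup (g (a, b0)) (g (a0, b))" using cd g_le that mem by simp
  qed
  have "splits x y z"
    unfolding splits_def
  proof (intro conjI allI impI yz)
    show "w = sup (inf w y) (inf w z)" if "w \<le> x" for w
      using g_onto[OF that] inf_y inf_z sup_g by auto
    fix u v assume "u \<le> y" "v \<le> z"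
    then obtain a b c d where ab: "a \<in> A" "b \<in> B" "u = g (a, b)" and cd: "c \<in> A" "d \<in> B" "v = g (c, d)"
      using g_onto yz by (meson order.trans)
    have "inf u y = u" "inf v z = v" using \<open>u \<le> y\<close> \<open>v \<le> z\<close> by (simp_all add: inf.absorb1)
    then have "u = g (a, b0)" "v = g (a0, d)"
      using inf_y[OF ab(1,2)] inf_z[OF cd(1,2)] ab(3) cd(3) by simp_all
    then have "sup u v = g (a, d)" using sup_g ab cd by simp
    then show "inf (sup u v) y = u" "inf (sup u v) z = v"
      using inf_y inf_z ab cd \<open>u = g (a, b0)\<close> \<open>v = g (a0, d)\<close> by auto
  qed
  moreover have "y \<noteq> bot"
  proof
    assume "y = bot"
    then have "a1 = a0" using fg(1)[OF mem(3,2)] by (simp add: y_def a0_def)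
    then have "A \<subseteq> {a0}" using bounds[OF _ mem(2)] trans by blast
    then show False using A(2) card_mono[of "{a0}" A] by simp
  qed
  moreover have "z \<noteq> bot"
  proof
    assume "z = bot"
    then have "b1 = b0" using fg(1)[OF mem(1,4)] by (simp add: z_def b0_def)
    then have "B \<subseteq> {b0}" using bounds[OF mem(1)] trans by blast
    then show False using B(2) card_mono[of "{b0}" B] by simp
  qed
  ultimately show thesis by (rule that)
qed

lemma irreducibles_iff:
  "(x::'a::geometric_lattice) \<in> irreducibles \<longleftrightarrow> x \<noteq> bot \<and> (\<forall>y z. splits x y z \<longrightarrow> y = bot \<or> z = bot)"
proof
  assume x: "x \<in> irreducibles"
  have "y = bot \<or> z = bot" if "splits x y z" for y z
    using splits_decomposable[OF that] x unfolding irreducibles_def by blast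
  then show "x \<noteq> bot \<and> (\<forall>y z. splits x y z \<longrightarrow> y = bot \<or> z = bot)"
    using x by (simp add: irreducibles_def bot.not_eq_extremum)
next
  assume x: "x \<noteq> bot \<and> (\<forall>y z. splits x y z \<longrightarrow> y = bot \<or> z = bot)"
  have "\<not> product_decomposable {bot..x}"
  proof
    assume "product_decomposable {bot..x}"
    then obtain y z where "splits x y z" "y \<noteq> bot" "z \<noteq> bot" by (rule decomposable_splits)
    with x show False by blast
  qed
  with x show "x \<in> irreducibles" by (simp add: irreducibles_def bot.not_eq_extremum)
qed

lemma splits_inf_eq_bot:
  assumes "splits x y (z::'a::bounded_lattice_bot)"
  shows "inf y z = bot"
proof -
  have meet: "\<And>u v. u \<le> y \<Longrightarrow> v \<le> z \<Longrightarrow> inf (sup u v) z = v" using assms by (auto simp: splits_def)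
  have "inf (sup y bot) z = bot" by (rule meet) auto
  then show ?thesis by simp
qed

lemma splits_sup_eq:
  assumes "splits x y (z::'a::bounded_lattice_bot)"
  shows "sup y z = x"
proof -
  have "x = sup (inf x y) (inf x z)" "y \<le> x" "z \<le> x" using assms by (auto simp: splits_def)
  then show ?thesis by (simp add: inf.absorb2)
qed

lemma splits_commute: "splits x y z \<Longrightarrow> splits x z y"
  unfolding splits_def by (metis sup.commute)

lemma splits_below:
  assumes "splits x y (z::'a::lattice)" "w \<le> x"
  shows "splits w (inf w y) (inf w z)"
proof -
  have meet: "inf (sup u v) y = u" "inf (sup u v) z = v" if "u \<le> y" "v \<le> z" for u v
    using assms(1) that by (auto simp: splits_def)
  show ?thesis
    unfolding splits_def
  proof (intro conjI allI impI)
    fix t assume "t \<le> w"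
    then have "t = sup (inf t y) (inf t z)" using assms unfolding splits_def by (meson order.trans)
    then show "t = sup (inf t (inf w y)) (inf t (inf w z))"
      using \<open>t \<le> w\<close> by (simp add: inf.assoc[symmetric] inf.absorb1)
  next
    fix u v assume uv: "u \<le> inf w y" "v \<le> inf w z"
    then have "sup u v \<le> w" by simp
    then show "inf (sup u v) (inf w y) = u" "inf (sup u v) (inf w z) = v"
      using meet[of u v] uv by (simp_all add: inf.assoc[symmetric] inf.absorb1)
  qed auto
qed

text \<open>Otherwise the decomposition of \<open>x\<close> would induce a nontrivial one of \<open>h\<close>.\<close>

lemma irreducible_splits_cases:
  assumes "splits x y z" "h \<in> irreducibles" "h \<le> (x::'a::geometric_lattice)"
  shows "h \<le> y \<or> h \<le> z"
proof -
  have s: "splits h (inf h y) (inf h z)" by (rule splits_below[OF assms(1,3)])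
  then have "inf h y = bot \<or> inf h z = bot" using assms(2) by (auto simp: irreducibles_iff)
  moreover have "sup (inf h y) (inf h z) = h" by (rule splits_sup_eq[OF s])
  ultimately show ?thesis by (metis inf.cobounded2 sup_bot.left_neutral sup_bot.right_neutral)
qed

lemma atom_irreducible:
  assumes "a \<in> atoms"
  shows "a \<in> (irreducibles :: 'a::geometric_lattice set)"
  unfolding irreducibles_iff
proof (intro conjI allI impI)
  show "a \<noteq> bot" using atom_gt_bot[OF assms] by simp
  fix y z assume s: "splits a y z"
  have "y = bot \<or> y = a" "z = bot \<or> z = a"
    using s assms by (auto simp: splits_def atoms_def covers_def less_le)
  then show "y = bot \<or> z = bot" using splits_inf_eq_bot[OF s] by auto
qed

lemma irreducible_below_factor:
  assumes "h \<in> irreducibles" "h \<le> (x::'a::geometric_lattice)"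
  obtains g where "g \<in> factors x" "h \<le> g"
proof -
  obtain g where g: "g \<in> {g \<in> irreducibles. h \<le> g \<and> g \<le> x}"
    "\<forall>k\<in>{g \<in> irreducibles. h \<le> g \<and> g \<le> x}. g \<le> k \<longrightarrow> g = k"
    using finite_has_maximal[of "{g \<in> irreducibles. h \<le> g \<and> g \<le> x}"] assms by auto
  then have "g \<in> factors x" unfolding factors_def using order.trans[of h g] by auto
  with g that show thesis by simp
qed

lemma factors_irreducible: "x \<in> irreducibles \<Longrightarrow> factors x = {x::'a::geometric_lattice}"
  by (auto simp: factors_def intro: antisym)

lemma factors_le: "g \<in> factors x \<Longrightarrow> g \<le> x"
  and factors_irr: "g \<in> factors x \<Longrightarrow> g \<in> irreducibles"
  and factors_maximal: "g \<in> factors x \<Longrightarrow> h \<in> irreducibles \<Longrightarrow> h \<le> x \<Longrightarrow> g \<le> h \<Longrightarrow> h = (g::'a::geometric_lattice)"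
  by (auto simp: factors_def)

lemma le_Sup_factors:
  assumes "w \<le> (x::'a::geometric_lattice)"
  shows "w \<le> (SUP g\<in>factors x. inf w g)"
proof (rule ccontr)
  assume "\<not> ?thesis"
  then obtain a where a: "a \<in> atoms" "a \<le> w" "\<not> a \<le> (SUP g\<in>factors x. inf w g)"
    by (rule exists_atom_not_below)
  then obtain g where "g \<in> factors x" "a \<le> g"
    using irreducible_below_factor atom_irreducible assms by (meson order.trans)
  then have "a \<le> inf w g" "inf w g \<le> (SUP g\<in>factors x. inf w g)" using a(2) by (auto intro: SUP_upper)
  with a(3) show False by (meson order.trans)
qed

lemma Sup_factors: "Sup (factors x) = (x::'a::geometric_lattice)"
proof (rule antisym)
  show "Sup (factors x) \<le> x" by (auto intro: Sup_least factors_le)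
  have "x \<le> (SUP g\<in>factors x. inf x g)" by (rule le_Sup_factors) simp
  also have "\<dots> = Sup (factors x)" by (rule arg_cong[where f = Sup]) (force simp: inf.absorb2 factors_le)
  finally show "x \<le> Sup (factors x)" .
qed

text \<open>This is the part of the isomorphism \<open>[bot, x] \<cong> \<Prod>\<^sub>g [bot, g]\<close>, over the factors \<open>g\<close> of \<open>x\<close>, that all
  later arguments rest on: the components \<open>u g\<close> of an element can be recovered from their join.
  If \<open>x\<close> splits into \<open>y\<close> and \<open>z\<close>, then its factors are those of \<open>y\<close> together with those of \<open>z\<close>, so the
  claim follows by induction.\<close>

lemma inf_SUP_factors:
  assumes "g \<in> factors (x::'a::geometric_lattice)" "\<And>h. h \<in> factors x \<Longrightarrow> u h \<le> h"
  shows "inf g (SUP h\<in>factors x. u h) = u g"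
  using assms
proof (induction "rank x" arbitrary: x g rule: less_induct)
  case less
  show ?case
  proof (cases "x \<in> irreducibles")
    case True
    then show ?thesis using less.prems factors_irreducible[of x] by (auto simp: inf.absorb2)
  next
    case False
    have "x \<noteq> bot" using factors_le[OF less.prems(1)] factors_irr[OF less.prems(1)]
      by (auto simp: irreducibles_iff bot_unique)
    then obtain y z where s: "splits x y z" "y \<noteq> bot" "z \<noteq> bot" using False by (auto simp: irreducibles_iff)
    have half: "factors y \<subseteq> factors x" "y < x" if s: "splits x y z" "z \<noteq> bot" for y z
    proof -
      have "y \<le> x" "z \<le> x" using s by (auto simp: splits_def)
      have disj: "inf y z = bot" by (rule splits_inf_eq_bot[OF s(1)])
      show "y < x" using s(2) disj \<open>z \<le> x\<close> \<open>y \<le> x\<close> by (auto simp: less_le inf.absorb2)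
      show "factors y \<subseteq> factors x"
      proof
        fix g assume g: "g \<in> factors y"
        have "h = g" if h: "h \<in> irreducibles" "h \<le> x" "g \<le> h" for h
        proof -
          have "\<not> h \<le> z"
          proof
            assume "h \<le> z"
            then have "g \<le> inf y z" using h(3) factors_le[OF g] by (meson le_inf_iff order.trans)
            then show False using disj factors_irr[OF g] by (auto simp: irreducibles_iff bot_unique)
          qed
          then have "h \<le> y" using irreducible_splits_cases[OF s(1) h(1,2)] by simp
          then show ?thesis using factors_maximal[OF g] h by simp
        qed
        then show "g \<in> factors x" using g factors_le[OF g] factors_irr[OF g] \<open>y \<le> x\<close> by (auto simp: factors_def)
      qed
    qed
    have s': "splits x z y" by (rule splits_commute[OF s(1)])
    have Un: "factors x = factors y \<union> factors z"
    proof
      show "factors x \<subseteq> factors y \<union> factors z"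
      proof
        fix g assume g: "g \<in> factors x"
        have "g \<le> y \<or> g \<le> z" by (rule irreducible_splits_cases[OF s(1) factors_irr[OF g] factors_le[OF g]])
        moreover have "g \<in> factors w" if "g \<le> w" "w \<le> x" for w
          using that g by (auto simp: factors_def)
        ultimately show "g \<in> factors y \<union> factors z" using s by (auto simp: splits_def)
      qed
    qed (use half[OF s(1,3)] half[OF s' s(2)] in auto)
    \<comment> \<open>The part of the join that comes from the other half of the splitting does not meet \<open>y\<close>.\<close>
    have step: "inf g (SUP h\<in>factors x. u h) = u g"
      if s: "splits x y z" "z \<noteq> bot" "factors x = factors y \<union> factors z" "g \<in> factors y" for y z
    proof -
      define U V where "U = (SUP h\<in>factors y. u h)" and "V = (SUP h\<in>factors z. u h)"
      have "U \<le> y" unfolding U_def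
      proof (rule SUP_least)
        fix h assume h: "h \<in> factors y"
        then have "u h \<le> h" using s(3) less.prems(2) by simp
        also have "h \<le> y" using h by (rule factors_le)
        finally show "u h \<le> y" .
      qed
      moreover have "V \<le> z" unfolding V_def
      proof (rule SUP_least)
        fix h assume h: "h \<in> factors z"
        then have "u h \<le> h" using s(3) less.prems(2) by simp
        also have "h \<le> z" using h by (rule factors_le)
        finally show "u h \<le> z" .
      qed
      ultimately have UV: "inf (sup U V) y = U" using s(1) by (auto simp: splits_def)
      have "(SUP h\<in>factors x. u h) = sup U V" by (simp add: s(3) U_def V_def SUP_union)
      then have "inf g (SUP h\<in>factors x. u h) = inf (inf g y) (sup U V)"
        using factors_le[OF s(4)] by (simp add: inf.absorb1)
      also have "\<dots> = inf g (inf (sup U V) y)" by (simp add: inf.assoc inf.commute)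
      also have "\<dots> = inf g U" by (simp add: UV)
      also have "\<dots> = u g" unfolding U_def
        using rank_strict_mono[OF half(2)[OF s(1,2)]] s(3,4) less.prems(2) by (intro less.hyps) auto
      finally show ?thesis .
    qed
    from less.prems(1) Un consider "g \<in> factors y" | "g \<in> factors z" by blast
    then show ?thesis
      using step[OF s(1,3) Un] step[OF s' s(2)] Un by cases (auto simp: Un_commute)
  qed
qed

lemma factors_disjoint:
  assumes "g \<in> factors (x::'a::geometric_lattice)" "h \<in> factors x" "inf g h \<noteq> bot"
  shows "g = h"
proof (rule ccontr)
  assume "g \<noteq> h"
  define u where "u k = (if k = h then h else bot)" for k
  have "inf g (SUP k\<in>factors x. u k) = u g" by (rule inf_SUP_factors[OF assms(1)]) (simp add: u_def)
  then have "inf g (SUP k\<in>factors x. u k) = bot" using \<open>g \<noteq> h\<close> by (simp add: u_def)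
  moreover have "h \<le> (SUP k\<in>factors x. u k)" by (rule SUP_upper2[OF assms(2)]) (simp add: u_def)
  then have "inf g h \<le> inf g (SUP k\<in>factors x. u k)" by (rule inf_mono[OF order_refl])
  ultimately show False using assms(3) by (simp add: bot_unique)
qed

text \<open>Both elements lie below factors of their join; these factors meet, so they coincide.\<close>

lemma irreducible_sup:
  assumes "g \<in> irreducibles" "h \<in> irreducibles" "inf g h \<noteq> (bot::'a::geometric_lattice)"
  shows "sup g h \<in> irreducibles"
proof -
  obtain g' where g': "g' \<in> factors (sup g h)" "g \<le> g'"
    by (rule irreducible_below_factor[OF assms(1), of "sup g h"]) simp
  obtain h' where h': "h' \<in> factors (sup g h)" "h \<le> h'"
    by (rule irreducible_below_factor[OF assms(2), of "sup g h"]) simp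
  have "inf g h \<le> inf g' h'" using g' h' by (intro inf_mono)
  then have "inf g' h' \<noteq> bot" using assms(3) by (metis bot_unique)
  then have "g' = h'" by (rule factors_disjoint[OF g'(1) h'(1)])
  then have "sup g h = g'" using g' h' factors_le[OF g'(1)] by (simp add: antisym)
  then show ?thesis using factors_irr[OF g'(1)] by simp
qed

section \<open>Nested sets\<close>

text \<open>A more convenient form of nestedness: an arbitrary subset may be replaced by the antichain of its
  maximal elements, which has the same join.\<close>

lemma nested_iff:
  "nested S \<longleftrightarrow> S \<subseteq> irreducibles \<and>
    (\<forall>A\<subseteq>S. Sup A \<in> irreducibles \<longrightarrow> Sup A \<in> (A :: 'a::geometric_lattice set))"
proof
  assume S: "nested S"
  have "Sup A \<in> A" if A: "A \<subseteq> S" "Sup A \<in> irreducibles" for A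
  proof -
    define T where "T = {t \<in> A. \<forall>s\<in>A. t \<le> s \<longrightarrow> t = s}"
    have "s \<le> Sup T" if s: "s \<in> A" for s
    proof -
      obtain t where t: "t \<in> A" "s \<le> t" "\<forall>u\<in>A. t \<le> u \<longrightarrow> t = u"
        using finite_has_maximal2[OF finite s] by blast
      then have "t \<in> T" by (simp add: T_def)
      then show ?thesis using t(2) by (meson Sup_upper order.trans)
    qed
    moreover have "T \<subseteq> A" by (auto simp: T_def)
    ultimately have "Sup T = Sup A" by (intro antisym Sup_subset_mono Sup_least)
    have "\<forall>x\<in>T. \<forall>y\<in>T. x \<noteq> y \<longrightarrow> \<not> x \<le> y \<and> \<not> y \<le> x" by (auto simp: T_def)
    then have "\<not> card T \<ge> 2"
      using S \<open>T \<subseteq> A\<close> A \<open>Sup T = Sup A\<close> unfolding nested_def by (metis order.trans)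
    moreover have "T \<noteq> {}" using A(2) \<open>Sup T = Sup A\<close> by (auto simp: irreducibles_iff)
    then have "card T \<noteq> 0" by simp
    ultimately have "card T = 1" by linarith
    then obtain t where "T = {t}" by (auto simp: card_1_singleton_iff)
    then show ?thesis using \<open>Sup T = Sup A\<close> \<open>T \<subseteq> A\<close> by simp
  qed
  with S show "S \<subseteq> irreducibles \<and> (\<forall>A\<subseteq>S. Sup A \<in> irreducibles \<longrightarrow> Sup A \<in> A)"
    by (auto simp: nested_def)
next
  assume S: "S \<subseteq> irreducibles \<and> (\<forall>A\<subseteq>S. Sup A \<in> irreducibles \<longrightarrow> Sup A \<in> A)"
  have "Sup T \<notin> irreducibles"
    if T: "T \<subseteq> S" "card T \<ge> 2" "\<forall>x\<in>T. \<forall>y\<in>T. x \<noteq> y \<longrightarrow> \<not> x \<le> y \<and> \<not> y \<le> x" for T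
  proof
    assume "Sup T \<in> irreducibles"
    then have "Sup T \<in> T" using S T(1) by blast
    then have "T \<subseteq> {Sup T}" using T(3) by (auto dest: Sup_upper)
    then show False using card_mono[of "{Sup T}" T] T(2) by simp
  qed
  with S show "nested S" by (auto simp: nested_def)
qed

lemma nested_mono: "nested S \<Longrightarrow> A \<subseteq> S \<Longrightarrow> nested (A :: 'a::geometric_lattice set)"
  unfolding nested_iff by (meson order.trans)

text \<open>By the product structure below \<open>Sup D\<close>, each factor is the join of the members of \<open>D\<close> below it. Being
  irreducible, it is then one of them.\<close>

lemma factors_Sup_nested:
  assumes "nested (D :: 'a::geometric_lattice set)"
  shows "factors (Sup D) \<subseteq> D"
proof
  fix g assume g: "g \<in> factors (Sup D)"
  define u where "u h = Sup {d \<in> D. d \<le> h}" for h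
  have "Sup D \<le> (SUP h\<in>factors (Sup D). u h)"
  proof (rule Sup_least)
    fix d assume d: "d \<in> D"
    then have "d \<in> irreducibles" "d \<le> Sup D" using assms by (auto simp: nested_def intro: Sup_upper)
    then obtain h where h: "h \<in> factors (Sup D)" "d \<le> h" by (rule irreducible_below_factor)
    have "d \<le> u h" using d h(2) by (auto simp: u_def intro: Sup_upper)
    with h(1) show "d \<le> (SUP h\<in>factors (Sup D). u h)" by (rule SUP_upper2)
  qed
  then have "g \<le> inf g (SUP h\<in>factors (Sup D). u h)"
    using factors_le[OF g] by (metis le_inf_iff order.trans order_refl)
  also have "\<dots> = u g" by (rule inf_SUP_factors[OF g]) (auto simp: u_def intro: Sup_least)
  finally have "g \<le> u g" .
  moreover have "u g \<le> g" by (auto simp: u_def intro: Sup_least)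
  ultimately have "Sup {d \<in> D. d \<le> g} = g" by (simp add: u_def)
  then have "g \<in> {d \<in> D. d \<le> g}"
    using assms factors_irr[OF g] unfolding nested_iff by (metis (no_types, lifting) mem_Collect_eq subsetI)
  then show "g \<in> D" by simp
qed

lemma maximal_nested_insert:
  assumes "maximal_nested S" "nested (insert h S)"
  shows "h \<in> (S :: 'a::geometric_lattice set)"
  using assms unfolding maximal_nested_def by blast

text \<open>A factor \<open>g\<close> of \<open>top\<close> can be added to any nested set, because an irreducible join above \<open>g\<close> is
  \<open>g\<close> itself.\<close>

lemma maximal_nested_Sup:
  assumes "maximal_nested (S :: 'a::geometric_lattice set)"
  shows "Sup S = top"
proof -
  have S: "nested S" using assms by (simp add: maximal_nested_def)
  have "factors top \<subseteq> S"
  proof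
    fix g :: 'a assume g: "g \<in> factors top"
    have "nested (insert g S)"
      unfolding nested_iff
    proof (intro conjI allI impI)
      show "insert g S \<subseteq> irreducibles" using S factors_irr[OF g] by (auto simp: nested_def)
      fix A assume A: "A \<subseteq> insert g S" "Sup A \<in> irreducibles"
      show "Sup A \<in> A"
      proof (cases "g \<in> A")
        case True
        then have "g \<le> Sup A" by (rule Sup_upper)
        then have "Sup A = g" using factors_maximal[OF g A(2)] by simp
        with True show ?thesis by simp
      next
        case False
        then show ?thesis using A S unfolding nested_iff by blast
      qed
    qed
    with assms show "g \<in> S" by (rule maximal_nested_insert)
  qed
  then have "Sup (factors top) \<le> Sup S" by (rule Sup_subset_mono)
  then show ?thesis by (simp add: Sup_factors top_unique)
qed

text \<open>The join \<open>g'\<close> of the members of \<open>S\<close> strictly below \<open>g\<close> is not \<open>g\<close>, as \<open>g\<close> would have to be one of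
  them. If \<open>g\<close> did not cover it, there would be a gap \<open>g' < y < g\<close>. Some factor
  \<open>h\<close> of \<open>y\<close> is not below \<open>g'\<close>, hence not in \<open>S\<close>, and \<open>S\<close> together with \<open>h\<close> is still nested,
  which contradicts maximality.\<close>

lemma maximal_nested_covers_children:
  assumes "maximal_nested S" "g \<in> S"
  shows "covers g (Sup {s \<in> S. s < (g::'a::geometric_lattice)})"
proof -
  have S: "nested S" using assms(1) by (simp add: maximal_nested_def)
  have g: "g \<in> irreducibles" using S assms(2) by (auto simp: nested_def)
  define g' where "g' = Sup {s \<in> S. s < g}"
  have below: "s \<le> g'" if "s \<in> S" "s < g" for s using that by (auto simp: g'_def intro: Sup_upper)
  have "g' \<le> g" unfolding g'_def by (auto intro: Sup_least)
  have "g' \<noteq> g"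
  proof
    assume "g' = g"
    then have "factors g \<subseteq> {s \<in> S. s < g}"
      using factors_Sup_nested[of "{s \<in> S. s < g}"] nested_mono[OF S, of "{s \<in> S. s < g}"] by (auto simp: g'_def)
    then show False using factors_irreducible[OF g] by simp
  qed
  have False if y: "g' < y" "y < g" for y
  proof -
    have "\<exists>h\<in>factors y. \<not> h \<le> g'"
    proof (rule ccontr)
      assume "\<not> ?thesis"
      then have "Sup (factors y) \<le> g'" by (auto intro: Sup_least)
      then show False using y(1) by (simp add: Sup_factors)
    qed
    then obtain h where h: "h \<in> factors y" "\<not> h \<le> g'" by blast
    have "h < g" using factors_le[OF h(1)] y(2) by simp
    have "nested (insert h S)"
      unfolding nested_iff
    proof (intro conjI allI impI)
      show "insert h S \<subseteq> irreducibles" using S factors_irr[OF h(1)] by (auto simp: nested_def)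
      fix A assume A: "A \<subseteq> insert h S" "Sup A \<in> irreducibles"
      show "Sup A \<in> A"
      proof (cases "h \<in> A")
        case False
        then show ?thesis using A S unfolding nested_iff by blast
      next
        case hA: True
        then have h_le: "h \<le> Sup A" by (rule Sup_upper)
        show ?thesis
        proof (cases "\<exists>x\<in>A - {h}. \<not> x \<le> g'")
          case False
          then have "x \<le> y" if "x \<in> A" for x
            using that y(1) factors_le[OF h(1)] by (cases "x = h") (auto intro: order.trans)
          then have "Sup A \<le> y" by (rule Sup_least)
          then have "Sup A = h" using factors_maximal[OF h(1) A(2) _ h_le] by simp
          with hA show ?thesis by simp
        next
          case True
          then obtain x where x: "x \<in> A" "x \<in> S" "\<not> x \<le> g'" using A(1) by auto
          \<comment> \<open>As \<open>h\<close> lies below \<open>g\<close>, replacing it by \<open>g\<close> turns \<open>A\<close> into a subset of \<open>S\<close> whose join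
            is still irreducible.\<close>
          have "inf (Sup A) g \<noteq> bot"
          proof
            assume "inf (Sup A) g = bot"
            then have "h \<le> bot" using h_le \<open>h < g\<close> by (metis le_inf_iff less_imp_le)
            then show False using factors_irr[OF h(1)] by (auto simp: irreducibles_iff bot_unique)
          qed
          then have "sup (Sup A) g \<in> irreducibles" by (rule irreducible_sup[OF A(2) g])
          moreover have "sup (Sup A) g = Sup (insert g (A - {h}))"
          proof -
            have "sup (Sup A) g = sup (Sup (insert h (A - {h}))) g" using hA by (simp add: insert_absorb)
            also have "\<dots> = sup (sup g h) (Sup (A - {h}))" by (simp only: Sup_insert ac_simps)
            also have "sup g h = g" using \<open>h < g\<close> by (simp add: sup.absorb1)
            finally show ?thesis by simp
          qed
          moreover have "insert g (A - {h}) \<subseteq> S" using A(1) assms(2) by auto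
          ultimately have "sup (Sup A) g \<in> insert g (A - {h})" using S unfolding nested_iff by metis
          then consider "sup (Sup A) g = g" | "sup (Sup A) g \<in> A" by auto
          then show ?thesis
          proof cases
            case 1
            then have "Sup A \<le> g" by (simp add: sup.absorb_iff2)
            moreover have "x \<le> Sup A" using x(1) by (rule Sup_upper)
            moreover have "\<not> x < g" using below x(2,3) by blast
            ultimately have "x = Sup A" by (metis antisym order.trans less_le)
            with x(1) show ?thesis by simp
          next
            case 2
            then have "sup (Sup A) g = Sup A" by (intro antisym Sup_upper) auto
            with 2 show ?thesis by simp
          qed
        qed
      qed
    qed
    then have "h \<in> S" by (rule maximal_nested_insert[OF assms(1)])
    with below \<open>h < g\<close> h(2) show False by blast
  qed
  then show ?thesis using \<open>g' \<le> g\<close> \<open>g' \<noteq> g\<close> unfolding g'_def[symmetric] by (auto simp: covers_def)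
qed

text \<open>Removing a maximal element \<open>g\<close> from the down-set \<open>D\<close> lowers the join by exactly one cover: \<open>g\<close> is a factor
  of \<open>Sup D\<close>, so its meet with the remaining join is the join of the members strictly below \<open>g\<close>, which \<open>g\<close>
  covers, and semimodularity lifts this cover. In particular a maximal nested set has
  \<open>rank top\<close> elements.\<close>

lemma maximal_nested_rank:
  assumes "maximal_nested S" "D \<subseteq> S" "\<And>d s. d \<in> D \<Longrightarrow> s \<in> S \<Longrightarrow> s \<le> d \<Longrightarrow> s \<in> D"
  shows "rank (Sup D :: 'a::geometric_lattice) = card D"
  using assms(2,3)
proof (induction "card D" arbitrary: D)
  case 0
  then show ?case by (simp add: rank_bot)
next
  case (Suc n)
  have S: "nested S" using assms(1) by (simp add: maximal_nested_def)
  have D: "nested D" by (rule nested_mono[OF S Suc.prems(1)])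
  have "D \<noteq> {}" using Suc.hyps(2) by auto
  then obtain g where g: "g \<in> D" "\<forall>d\<in>D. g \<le> d \<longrightarrow> g = d" using finite_has_maximal[of D] by auto
  define x y where "x = Sup D" and "y = Sup (D - {g})"
  have "g \<in> irreducibles" using g(1) D by (auto simp: nested_def)
  then obtain h where h: "h \<in> factors x" "g \<le> h"
    using irreducible_below_factor[of g x] Sup_upper[OF g(1)] by (auto simp: x_def)
  moreover have fD: "factors x \<subseteq> D" unfolding x_def by (rule factors_Sup_nested[OF D])
  ultimately have gx: "g \<in> factors x" using g(2) by blast
  define u where "u h = (if h = g then Sup {s \<in> S. s < g} else h)" for h
  have "y \<le> (SUP h\<in>factors x. u h)"
    unfolding y_def
  proof (rule Sup_least)
    fix d assume d: "d \<in> D - {g}"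
    then have "d \<in> irreducibles" "d \<le> x" using D by (auto simp: nested_def x_def intro: Sup_upper)
    then obtain h where h: "h \<in> factors x" "d \<le> h" by (rule irreducible_below_factor)
    have "d \<le> u h" using d h(2) Suc.prems(1) by (auto simp: u_def less_le intro!: Sup_upper)
    with h(1) show "d \<le> (SUP h\<in>factors x. u h)" by (rule SUP_upper2)
  qed
  moreover have "(SUP h\<in>factors x. u h) \<le> y"
  proof (rule SUP_least)
    fix h assume h: "h \<in> factors x"
    have "{s \<in> S. s < g} \<subseteq> D - {g}" using Suc.prems(2)[OF g(1)] by auto
    then have "Sup {s \<in> S. s < g} \<le> y" unfolding y_def by (rule Sup_subset_mono)
    then show "u h \<le> y" using h fD by (auto simp: u_def y_def intro: Sup_upper)
  qed
  ultimately have y: "y = (SUP h\<in>factors x. u h)" by (rule antisym)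
  have "inf g y = u g"
    unfolding y by (rule inf_SUP_factors[OF gx]) (auto simp: u_def intro: Sup_least)
  then have "covers g (inf g y)"
    using maximal_nested_covers_children[OF assms(1)] g(1) Suc.prems(1) by (auto simp: u_def)
  then have "covers (sup g y) y" by (rule upper_semimodular)
  moreover have "sup g y = x" using Sup_insert[of g "D - {g}"] g(1) by (simp add: x_def y_def insert_absorb)
  ultimately have "rank x = Suc (rank y)" using rank_covers by metis
  also have "rank y = card (D - {g})"
    unfolding y_def
  proof (rule Suc.hyps(1))
    show "n = card (D - {g})" using Suc.hyps(2) g(1) by simp
    show "s \<in> D - {g}" if "d \<in> D - {g}" "s \<in> S" "s \<le> d" for d s
      using that Suc.prems(2)[of d s] g(2) by (auto intro: antisym)
  qed (use Suc.prems(1) in auto)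
  also have "Suc (card (D - {g})) = card D" using g(1) by (intro card_Suc_Diff1) auto
  finally show ?case by (simp add: x_def)
qed

section \<open>Maximal chains and maximal nested sets\<close>

text \<open>In a product of lattices, a coatom differs from the maximum in exactly one coordinate.\<close>

lemma covers_unique_new_factor:
  assumes "covers x (y::'a::geometric_lattice)"
  shows "\<exists>!g. g \<in> factors x \<and> \<not> g \<le> y"
proof -
  have "y \<le> x" "\<not> x \<le> y" using assms by (auto simp: covers_def)
  have "g = h" if g: "g \<in> factors x" "\<not> g \<le> y" and h: "h \<in> factors x" "\<not> h \<le> y" for g h
  proof (rule ccontr)
    assume "g \<noteq> h"
    define u where "u k = (if k = h then h else inf y k)" for k
    have "h \<le> (SUP k\<in>factors x. u k)" by (rule SUP_upper2[OF h(1)]) (simp add: u_def)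
    moreover have "y \<le> (SUP k\<in>factors x. u k)"
      using le_Sup_factors[OF \<open>y \<le> x\<close>]
      by (rule order.trans) (rule SUP_subset_mono[OF order_refl], simp add: u_def)
    ultimately have "x \<le> (SUP k\<in>factors x. u k)"
      using covers_sup_eq[OF assms factors_le[OF h(1)] h(2)] by (metis le_sup_iff)
    then have "g \<le> inf g (SUP k\<in>factors x. u k)" using factors_le[OF g(1)] by (metis le_inf_iff order.trans order_refl)
    also have "\<dots> = u g" by (rule inf_SUP_factors[OF g(1)]) (auto simp: u_def)
    also have "\<dots> \<le> y" using \<open>g \<noteq> h\<close> by (simp add: u_def)
    finally show False using g(2) by simp
  qed
  moreover have "\<exists>g\<in>factors x. \<not> g \<le> y"
  proof (rule ccontr)
    assume "\<not> ?thesis"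
    then have "Sup (factors x) \<le> y" by (auto intro: Sup_least)
    then show False using \<open>\<not> x \<le> y\<close> by (simp add: Sup_factors)
  qed
  ultimately show ?thesis by blast
qed

lemma factors_anti_mono:
  assumes "h \<in> factors x" "h \<le> y" "y \<le> (x::'a::geometric_lattice)"
  shows "h \<in> factors y"
  using assms unfolding factors_def by (auto intro: order.trans)

text \<open>Since \<open>z \<squnion> y = x\<close> and \<open>y\<close> differs from \<open>x\<close> only in the coordinate \<open>g\<close>, comparing this coordinate
  on both sides gives the claim.\<close>

lemma new_factor_sup:
  assumes "covers x (y::'a::geometric_lattice)" "g \<in> factors x" "\<not> g \<le> y" "z \<le> g" "\<not> z \<le> y"
  shows "sup z (inf g y) = g"
proof -
  have "y \<le> x" using assms(1) by (auto simp: covers_def)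
  define u where "u h = (if h = g then sup z (inf g y) else h)" for h
  have ug: "u g \<le> g" using assms(4) by (simp add: u_def)
  have "z \<le> (SUP h\<in>factors x. u h)" by (rule SUP_upper2[OF assms(2)]) (simp add: u_def)
  moreover have "y \<le> (SUP h\<in>factors x. u h)"
    using le_Sup_factors[OF \<open>y \<le> x\<close>] 
    by (rule order.trans) (rule SUP_subset_mono[OF order_refl], simp add: u_def inf.commute)
  ultimately have "x \<le> (SUP h\<in>factors x. u h)"
    using covers_sup_eq[OF assms(1) _ assms(5)] assms(4) factors_le[OF assms(2)] by (metis le_sup_iff order.trans)
  then have "g \<le> inf g (SUP h\<in>factors x. u h)" using factors_le[OF assms(2)] by (metis le_inf_iff order.trans order_refl)
  also have "\<dots> = u g" by (rule inf_SUP_factors[OF assms(2)]) (use ug in \<open>auto simp: u_def\<close>)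
  finally show ?thesis using ug by (intro antisym) (auto simp: u_def)
qed

lemma factors_inf_factor:
  assumes "y \<le> x" "g \<in> factors (x::'a::geometric_lattice)"
  shows "factors (inf g y) \<subseteq> factors y"
proof
  fix h assume h: "h \<in> factors (inf g y)"
  have hg: "h \<le> g" "h \<le> y" using factors_le[OF h] by auto
  have "k = h" if k: "k \<in> irreducibles" "k \<le> y" "h \<le> k" for k
  proof -
    have "k \<le> x" using k(2) assms(1) by (rule order.trans)
    with k(1) obtain f where f: "f \<in> factors x" "k \<le> f" by (rule irreducible_below_factor)
    have "h \<le> inf g f" using hg k(3) f(2) by simp
    then have "inf g f \<noteq> bot" using factors_irr[OF h] unfolding irreducibles_iff by (metis bot_unique)
    then have "f = g" using factors_disjoint[OF assms(2) f(1)] by simp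
    with f k show ?thesis using factors_maximal[OF h k(1)] by simp
  qed
  then show "h \<in> factors y" using hg(2) factors_irr[OF h] by (auto simp: factors_def)
qed

lemma factors_bot: "factors (bot::'a::geometric_lattice) = {}"
  by (auto simp: factors_def irreducibles_iff bot_unique)

lemma Theta_nth:
  assumes "maximal_chain (cs :: 'a::geometric_lattice list)"
  shows "Theta cs = (\<Union>i<rank (top::'a). factors (cs ! Suc i))"
proof -
  have "set (tl cs) = (\<lambda>i. cs ! Suc i) ` {..<rank (top::'a)}"
  proof -
    have "length (tl cs) = rank (top::'a)" using assms by (simp add: maximal_chain_iff)
    moreover then have "tl cs ! i = cs ! Suc i" if "i < rank (top::'a)" for i using that by (simp add: nth_tl)
    ultimately show ?thesis by (force simp: set_conv_nth)
  qed
  then show ?thesis by (simp add: Theta_def)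
qed

text \<open>Each step of the chain contributes just its new factor: an old factor of \<open>cs ! Suc i\<close> is already a
  factor of \<open>cs ! i\<close>.\<close>

lemma Theta_new_factors:
  fixes cs :: "'a::geometric_lattice list"
  assumes "maximal_chain cs"
    and "\<And>i. i < rank (top::'a) \<Longrightarrow> s i \<in> factors (cs ! Suc i) \<and> \<not> s i \<le> cs ! i"
  shows "Theta cs = s ` {..<rank (top::'a)}"
proof
  let ?r = "rank (top::'a)"
  have c: "cs ! 0 = bot" "\<And>i. i < ?r \<Longrightarrow> covers (cs ! Suc i) (cs ! i)"
    using assms(1) by (auto simp: maximal_chain_iff)
  show "s ` {..<?r} \<subseteq> Theta cs" using assms Theta_nth by blast
  have "factors (cs ! i) \<subseteq> s ` {..<i}" if "i \<le> ?r" for i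
    using that
  proof (induction i)
    case (Suc i)
    show ?case
    proof
      fix h assume h: "h \<in> factors (cs ! Suc i)"
      show "h \<in> s ` {..<Suc i}"
      proof (cases "h \<le> cs ! i")
        case True
        then have "h \<in> factors (cs ! i)"
          using factors_anti_mono[OF h] c(2)[of i] Suc.prems True by (auto simp: covers_def)
        then show ?thesis using Suc by (auto simp: less_Suc_eq)
      next
        case False
        then have "h = s i"
          using covers_unique_new_factor[OF c(2)[of i]] assms(2)[of i] h Suc.prems by auto
        then show ?thesis by simp
      qed
    qed
  qed (simp add: c factors_bot)
  then have "factors (cs ! Suc i) \<subseteq> s ` {..<?r}" if "i < ?r" for i
    using that by (meson Suc_leI image_mono lessThan_subset_iff order.trans)
  then show "Theta cs \<subseteq> s ` {..<?r}" using Theta_nth[OF assms(1)] by blast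
qed

lemma new_factors_exist:
  fixes cs :: "'a::geometric_lattice list"
  assumes "maximal_chain cs"
  obtains s where "\<And>i. i < rank (top::'a) \<Longrightarrow> s i \<in> factors (cs ! Suc i) \<and> \<not> s i \<le> cs ! i"
proof -
  have "\<exists>g. g \<in> factors (cs ! Suc i) \<and> \<not> g \<le> cs ! i" if "i < rank (top::'a)" for i
    using covers_unique_new_factor[of "cs ! Suc i" "cs ! i"] assms that by (auto simp: maximal_chain_iff)
  with that show thesis by metis
qed

lemma maximal_chain_nth_mono:
  fixes cs :: "'a::geometric_lattice list"
  assumes "maximal_chain cs" "i \<le> j" "j \<le> rank (top::'a)"
  shows "cs ! i \<le> cs ! j"
proof (cases "i = j")
  case False
  have "sorted_wrt (<) cs" using assms(1) by (simp add: maximal_chain_def)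
  moreover have "j < length cs" using assms(1,3) by (simp add: maximal_chain_iff)
  ultimately have "cs ! i < cs ! j" using assms(2) False sorted_wrt_nth_less[of "(<)" cs i j] by simp
  then show ?thesis by simp
qed simp

lemma maximal_chain_top:
  fixes cs :: "'a::geometric_lattice list"
  assumes "maximal_chain cs"
  shows "cs ! rank (top::'a) = top"
proof -
  have "rank (cs ! rank (top::'a)) = rank (top::'a)"
    using assms by (intro covers_nth_rank) (auto simp: maximal_chain_iff)
  then show ?thesis by (intro eq_if_le_rank) auto
qed

text \<open>For nestedness, consider the last step of the chain whose new factor \<open>s m\<close> belongs to \<open>A\<close>. An
  irreducible join of \<open>A\<close> lies between \<open>s m\<close> and \<open>cs ! Suc m\<close>, so it equals \<open>s m\<close>. For maximality,
  the first chain element above an additional irreducible element \<open>z\<close> provides a member \<open>g\<close> of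
  \<open>Theta cs\<close> that is the join of \<open>z\<close> with smaller members, which nestedness forbids.\<close>

lemma Theta_maximal_nested:
  fixes cs :: "'a::geometric_lattice list"
  assumes "maximal_chain cs"
  shows "maximal_nested (Theta cs)"
proof -
  let ?r = "rank (top::'a)"
  have c: "cs ! 0 = bot" "\<And>i. i < ?r \<Longrightarrow> covers (cs ! Suc i) (cs ! i)"
    using assms by (auto simp: maximal_chain_iff)
  obtain s where s: "\<And>i. i < ?r \<Longrightarrow> s i \<in> factors (cs ! Suc i) \<and> \<not> s i \<le> cs ! i"
    using new_factors_exist[OF assms] by blast
  have Theta: "Theta cs = s ` {..<?r}" by (rule Theta_new_factors[OF assms s])
  have "nested (Theta cs)"
    unfolding nested_iff
  proof (intro conjI allI impI)
    show "Theta cs \<subseteq> irreducibles" by (auto simp: Theta_def factors_irr)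
    fix A assume A: "A \<subseteq> Theta cs" "Sup A \<in> irreducibles"
    define I where "I = {i. i < ?r \<and> s i \<in> A}"
    have "A = s ` I" using A(1) by (auto simp: Theta I_def)
    have "I \<noteq> {}" using A(2) \<open>A = s ` I\<close> by (auto simp: irreducibles_iff)
    have "finite I" by (simp add: I_def)
    define m where "m = Max I"
    have m: "m \<in> I" "\<And>i. i \<in> I \<Longrightarrow> i \<le> m" using \<open>finite I\<close> \<open>I \<noteq> {}\<close> by (auto simp: m_def)
    then have "m < ?r" "s m \<in> A" by (auto simp: I_def)
    have "s i \<le> cs ! Suc m" if "i \<in> I" for i
    proof -
      have "s i \<le> cs ! Suc i" using s[of i] that by (auto simp: I_def intro: factors_le)
      also have "\<dots> \<le> cs ! Suc m" using m(2)[OF that] \<open>m < ?r\<close> by (intro maximal_chain_nth_mono[OF assms]) auto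
      finally show ?thesis .
    qed
    then have "Sup A \<le> cs ! Suc m" using \<open>A = s ` I\<close> by (auto intro: Sup_least)
    moreover have "s m \<le> Sup A" using \<open>s m \<in> A\<close> by (rule Sup_upper)
    ultimately have "Sup A = s m" using s[OF \<open>m < ?r\<close>] A(2) factors_maximal by blast
    with \<open>s m \<in> A\<close> show "Sup A \<in> A" by simp
  qed
  moreover have "T = Theta cs" if T: "nested T" "Theta cs \<subseteq> T" for T
  proof (rule ccontr)
    assume "T \<noteq> Theta cs"
    then obtain z where z: "z \<in> T" "z \<notin> Theta cs" using T(2) by blast
    have z_irr: "z \<in> irreducibles" using T(1) z(1) by (auto simp: nested_def)
    then have "\<not> z \<le> cs ! 0" by (auto simp: c irreducibles_iff bot_unique)
    moreover have "z \<le> cs ! ?r" by (simp add: maximal_chain_top[OF assms])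
    ultimately obtain i where i: "i < ?r" "\<not> z \<le> cs ! i" "z \<le> cs ! Suc i"
      using ex_least_nat_less[of "\<lambda>i. z \<le> cs ! i" ?r] by auto
    obtain g where g: "g \<in> factors (cs ! Suc i)" "z \<le> g"
      by (rule irreducible_below_factor[OF z_irr i(3)])
    have cov: "covers (cs ! Suc i) (cs ! i)" by (rule c(2)[OF i(1)])
    have le: "cs ! i \<le> cs ! Suc i" using cov by (auto simp: covers_def)
    have "\<not> g \<le> cs ! i" using g(2) i(2) by (meson order.trans)
    have gT: "g \<in> Theta cs" using g(1) i(1) Theta_nth[OF assms] by blast
    define w where "w = inf g (cs ! i)"
    have "w \<le> cs ! i" by (simp add: w_def)
    \<comment> \<open>\<open>g\<close> is the join of \<open>z\<close> and the part \<open>w\<close> of \<open>g\<close> that is already below \<open>cs ! i\<close>, and the factors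
      of \<open>w\<close> belong to \<open>Theta cs\<close>.\<close>
    have "Sup (insert z (factors w)) = g"
      using new_factor_sup[OF cov g(1) \<open>\<not> g \<le> cs ! i\<close> g(2) i(2)] by (simp add: Sup_factors w_def)
    moreover have "factors w \<subseteq> Theta cs"
    proof (cases i)
      case 0
      then have "w = bot" using \<open>w \<le> cs ! i\<close> c(1) by (simp add: bot_unique)
      then show ?thesis by (simp add: factors_bot)
    next
      case (Suc j)
      have "factors w \<subseteq> factors (cs ! i)" unfolding w_def by (rule factors_inf_factor[OF le g(1)])
      then show ?thesis using Theta_nth[OF assms] i(1) Suc by fastforce
    qed
    then have "insert z (factors w) \<subseteq> T" using z(1) T(2) by auto
    ultimately have "g \<in> insert z (factors w)"
      using T(1) factors_irr[OF g(1)] unfolding nested_iff by metis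
    moreover have "g \<noteq> z" using gT z(2) by auto
    ultimately have "g \<le> w" by (auto intro: factors_le)
    then show False using \<open>\<not> g \<le> cs ! i\<close> \<open>w \<le> cs ! i\<close> by (meson order.trans)
  qed
  ultimately show ?thesis by (auto simp: maximal_nested_def)
qed

section \<open>Minima and descending lists\<close>

abbreviation descending :: "'a rel \<Rightarrow> 'a list \<Rightarrow> bool" where
  "descending \<omega> \<equiv> sorted_wrt (\<lambda>a b. less_wrt \<omega> b a)"

context
  fixes A :: "'b set" and \<omega> :: "'b rel"
  assumes lin: "linear_order_on A \<omega>"
begin

lemma refl_wrt: "a \<in> A \<Longrightarrow> (a, a) \<in> \<omega>"
  and trans_wrt: "(a, b) \<in> \<omega> \<Longrightarrow> (b, c) \<in> \<omega> \<Longrightarrow> (a, c) \<in> \<omega>"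
  and antisym_wrt: "(a, b) \<in> \<omega> \<Longrightarrow> (b, a) \<in> \<omega> \<Longrightarrow> a = b"
  and total_wrt: "a \<in> A \<Longrightarrow> b \<in> A \<Longrightarrow> (a, b) \<in> \<omega> \<or> (b, a) \<in> \<omega>"
  using lin by (auto simp: order_on_defs refl_on_def total_on_def dest: transD antisymD) metis

lemma min_wrt_eqI:
  assumes "m \<in> S" "\<And>b. b \<in> S \<Longrightarrow> (m, b) \<in> \<omega>"
  shows "min_wrt \<omega> S = m"
  unfolding min_wrt_def using assms antisym_wrt by (intro the_equality) auto

lemma exists_min_wrt:
  assumes "finite S" "S \<noteq> {}" "S \<subseteq> A"
  shows "\<exists>m\<in>S. \<forall>b\<in>S. (m, b) \<in> \<omega>"
  using assms
proof (induction rule: finite_ne_induct)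
  case (singleton a)
  then show ?case using refl_wrt by simp
next
  case (insert a S)
  then obtain m where m: "m \<in> S" "\<forall>b\<in>S. (m, b) \<in> \<omega>" by auto
  have am: "a \<in> A" "m \<in> A" using insert.prems m(1) by auto
  then consider "(m, a) \<in> \<omega>" | "(a, m) \<in> \<omega>" using total_wrt by blast
  then show ?case
  proof cases
    case 1
    with m show ?thesis by auto
  next
    case 2
    then have "\<forall>b\<in>insert a S. (a, b) \<in> \<omega>" using m(2) am refl_wrt trans_wrt by blast
    then show ?thesis by blast
  qed
qed

lemma min_wrt_in_least:
  assumes "finite S" "S \<noteq> {}" "S \<subseteq> A"
  shows "min_wrt \<omega> S \<in> S" "b \<in> S \<Longrightarrow> (min_wrt \<omega> S, b) \<in> \<omega>"
proof -
  obtain m where m: "m \<in> S" "\<And>b. b \<in> S \<Longrightarrow> (m, b) \<in> \<omega>" using exists_min_wrt[OF assms] by blast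
  then have "min_wrt \<omega> S = m" by (rule min_wrt_eqI)
  with m show "min_wrt \<omega> S \<in> S" "b \<in> S \<Longrightarrow> (min_wrt \<omega> S, b) \<in> \<omega>" by auto
qed

lemma sorted_list_exists:
  assumes "finite S" "S \<subseteq> A"
  shows "\<exists>as. sorted_wrt (less_wrt \<omega>) as \<and> set as = S"
  using assms
proof (induction "card S" arbitrary: S)
  case 0
  then show ?case by simp
next
  case (Suc n)
  then have "S \<noteq> {}" by auto
  then obtain m where m: "m \<in> S" "\<forall>b\<in>S. (m, b) \<in> \<omega>" using exists_min_wrt Suc.prems by blast
  have "n = card (S - {m})" using Suc.hyps(2) Suc.prems(1) m(1) by simp
  then obtain as where "sorted_wrt (less_wrt \<omega>) as" "set as = S - {m}"
    using Suc.hyps(1)[of "S - {m}"] Suc.prems by auto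
  then have "sorted_wrt (less_wrt \<omega>) (m # as)" "set (m # as) = S"
    using m by (auto simp: less_wrt_def)
  then show ?case by blast
qed

lemma sorted_list_unique:
  assumes "sorted_wrt (less_wrt \<omega>) as" "sorted_wrt (less_wrt \<omega>) bs" "set as = set bs"
  shows "as = bs"
  using assms
proof (induction as arbitrary: bs)
  case Nil
  then show ?case by simp
next
  case (Cons a as)
  then obtain b bs' where bs: "bs = b # bs'" by (cases bs) auto
  have "a = b"
  proof (rule ccontr)
    assume "a \<noteq> b"
    then have "less_wrt \<omega> a b" "less_wrt \<omega> b a" using Cons.prems bs by (auto dest: sym)
    then show False using antisym_wrt by (auto simp: less_wrt_def)
  qed
  moreover have "a \<notin> set as" "b \<notin> set bs'" using Cons.prems bs by (auto simp: less_wrt_def)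
  then have "set as = set bs'" using Cons.prems(3) bs \<open>a = b\<close> by auto
  then have "as = bs'" using Cons bs by simp
  ultimately show ?case using bs by simp
qed

lemma ascending_list_rev_descending:
  assumes "descending \<omega> bs"
  shows "ascending_list \<omega> (set bs) = rev bs"
  unfolding ascending_list_def
proof (rule the_equality)
  show bs: "sorted_wrt (less_wrt \<omega>) (rev bs) \<and> set (rev bs) = set bs"
    using assms by (simp add: sorted_wrt_rev)
  show "as = rev bs" if "sorted_wrt (less_wrt \<omega>) as \<and> set as = set bs" for as
    using that bs by (intro sorted_list_unique) auto
qed

lemma descending_list_exists:
  assumes "finite S" "S \<subseteq> A"
  obtains bs where "descending \<omega> bs" "set bs = S"
proof -
  obtain as where "sorted_wrt (less_wrt \<omega>) as" "set as = S"
    using sorted_list_exists[OF assms] by blast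
  then have "descending \<omega> (rev as)" "set (rev as) = S" by (simp_all add: sorted_wrt_rev)
  then show thesis by (rule that)
qed

end

lemma descending_distinct: "descending \<omega> bs \<Longrightarrow> distinct bs"
  by (induction bs) (auto simp: less_wrt_def)

lemma descending_nth:
  assumes "descending \<omega> bs" "i < j" "j < length bs"
  shows "(bs ! j, bs ! i) \<in> \<omega>" "bs ! j \<noteq> bs ! i"
  using sorted_wrt_nth_less[OF assms] by (auto simp: less_wrt_def)

section \<open>Decreasing chains\<close>

text \<open>This is the chain that \<open>Psi\<close> builds from a basis listed in descending order.\<close>

definition joins :: "'a::complete_lattice list \<Rightarrow> 'a list" where
  "joins bs = map (\<lambda>k. Sup (set (take k bs))) [0..<Suc (length bs)]"

lemma length_joins: "length (joins bs) = Suc (length bs)"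
  by (simp add: joins_def)

lemma nth_joins: "k \<le> length bs \<Longrightarrow> joins bs ! k = Sup (set (take k bs))"
  by (simp add: joins_def del: upt_Suc)

lemma joins_0: "joins bs ! 0 = bot"
  by (simp add: nth_joins)

lemma joins_Suc:
  assumes "k < length bs"
  shows "joins bs ! Suc k = sup (joins bs ! k) (bs ! k)"
  using assms by (simp add: nth_joins take_Suc_conv_app_nth sup.commute)

lemma joins_length: "joins bs ! length bs = Sup (set bs)"
  by (simp add: nth_joins)

lemma nth_le_joins:
  assumes "i < k" "k \<le> length bs"
  shows "bs ! i \<le> joins bs ! k"
proof -
  have "bs ! i \<in> set (take k bs)" using assms by (auto simp: in_set_conv_nth intro!: exI[of _ i])
  then show ?thesis using assms by (simp add: nth_joins Sup_upper)
qed

text \<open>Each entry of the list is the minimal atom below the flat spanned by the entries up to it. For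
  a descending list whose entries form a basis, this is the common reformulation of being free
  of broken circuits, of having a decreasing chain of joins, and of coming from a proper maximal
  nested set.\<close>

definition flat_minimal :: "'a::geometric_lattice rel \<Rightarrow> 'a list \<Rightarrow> bool" where
  "flat_minimal \<omega> bs \<longleftrightarrow> (\<forall>k<length bs. \<forall>a\<in>atoms_below (joins bs ! Suc k). (bs ! k, a) \<in> \<omega>)"

lemma basis_distinct_joins:
  fixes bs :: "'a::geometric_lattice list"
  assumes "basis (set bs)" "distinct bs"
  shows "length bs = rank (top::'a)"
    and "k < length bs \<Longrightarrow> covers (joins bs ! Suc k) (joins bs ! k)"
    and "k < length bs \<Longrightarrow> \<not> bs ! k \<le> joins bs ! k"
    and "maximal_chain (joins bs)"
    and "k \<le> length bs \<Longrightarrow> rank (joins bs ! k) = k"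
proof -
  show len: "length bs = rank (top::'a)"
    using basis_card[OF assms(1)] assms(2) by (simp add: distinct_card)
  have notle: "\<not> bs ! k \<le> joins bs ! k \<and> bs ! k \<in> atoms" if k: "k < length bs" for k
  proof -
    have "set (take (Suc k) bs) \<subseteq> set bs" by (rule set_take_subset)
    then have "independent (set (take (Suc k) bs))"
      using assms(1) independent_mono by (auto simp: basis_def)
    moreover have "set (take (Suc k) bs) = insert (bs ! k) (set (take k bs))"
      using k by (simp add: take_Suc_conv_app_nth)
    moreover have "bs ! k \<notin> set (take k bs)"
      using k assms(2) by (auto simp: in_set_conv_nth nth_eq_iff_index_eq)
    ultimately show ?thesis using k independent_insert_iff[of "bs ! k" "set (take k bs)"] by (simp add: nth_joins)
  qed
  show "\<not> bs ! k \<le> joins bs ! k" if "k < length bs" using notle[OF that] by simp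
  have cov: "covers (joins bs ! Suc k) (joins bs ! k)" if "k < length bs" for k
    using covers_sup_atom[of "bs ! k" "joins bs ! k"] notle[OF that] joins_Suc[OF that] by simp
  then show "covers (joins bs ! Suc k) (joins bs ! k)" if "k < length bs" using that by simp
  show "maximal_chain (joins bs)"
    unfolding maximal_chain_iff using cov by (auto simp: length_joins len joins_0)
  show "rank (joins bs ! k) = k" if "k \<le> length bs"
    using that by (intro covers_nth_rank cov) (auto simp: length_joins joins_0)
qed

lemma length_label_sequence:
  "length (label_sequence \<omega> cs) = length cs - 1"
  by (simp add: label_sequence_def)

lemma nth_label_sequence:
  "Suc i < length cs \<Longrightarrow> label_sequence \<omega> cs ! i = label \<omega> (cs ! Suc i) (cs ! i)"
  by (simp add: label_sequence_def nth_tl nth_butlast)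

lemma Psi_set_descending:
  assumes "linear_order_on atoms (\<omega> :: 'a::geometric_lattice rel)" "descending \<omega> bs"
  shows "Psi \<omega> (set bs) = joins bs"
  by (simp add: Psi_def ascending_list_rev_descending[OF assms] joins_def)

lemma joins_dc:
  fixes \<omega> :: "'a::geometric_lattice rel"
  assumes lin: "linear_order_on atoms \<omega>"
    and bs: "descending \<omega> bs" "basis (set bs)" "flat_minimal \<omega> bs"
  shows "joins bs \<in> dc \<omega>" "label_sequence \<omega> (joins bs) = bs"
proof -
  note bj = basis_distinct_joins[OF bs(2) descending_distinct[OF bs(1)]]
  have atoms: "set bs \<subseteq> atoms" using bs(2) by (auto simp: basis_def independent_def)
  show eq: "label_sequence \<omega> (joins bs) = bs"
  proof (rule nth_equalityI)
    show "length (label_sequence \<omega> (joins bs)) = length bs" by (simp add: length_label_sequence length_joins)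
    fix k assume "k < length (label_sequence \<omega> (joins bs))"
    then have k: "k < length bs" by (simp add: length_label_sequence length_joins)
    then have "bs ! k \<in> atoms" using atoms nth_mem by blast
    then have "bs ! k \<in> atoms_below (joins bs ! Suc k) - atoms_below (joins bs ! k)"
      using k bj(3)[OF k] nth_le_joins[of k "Suc k" bs] by (simp add: atoms_below_def)
    then have "label \<omega> (joins bs ! Suc k) (joins bs ! k) = bs ! k"
      unfolding label_def using bs(3) k by (intro min_wrt_eqI[OF lin]) (auto simp: flat_minimal_def)
    then show "label_sequence \<omega> (joins bs) ! k = bs ! k"
      using k by (simp add: nth_label_sequence length_joins)
  qed
  show "joins bs \<in> dc \<omega>" using bj(4) bs(1) eq by (simp add: dc_def)
qed

text \<open>The labels are successively independent, because each of them is not below the preceding chain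
  element. An atom below \<open>cs ! Suc k\<close> appears at some step \<open>j \<le> k\<close>, so it is not smaller than the
  label of that step, which in turn is not smaller than the label of step \<open>k\<close>.\<close>

lemma dc_joins_label_sequence:
  fixes \<omega> :: "'a::geometric_lattice rel"
  assumes lin: "linear_order_on atoms \<omega>" and cs: "cs \<in> dc \<omega>"
  shows "descending \<omega> (label_sequence \<omega> cs)" "basis (set (label_sequence \<omega> cs))"
    "flat_minimal \<omega> (label_sequence \<omega> cs)" "joins (label_sequence \<omega> cs) = cs"
proof -
  let ?r = "rank (top::'a)"
  define bs where "bs = label_sequence \<omega> cs"
  have max: "maximal_chain cs" and desc: "descending \<omega> bs" using cs by (auto simp: dc_def bs_def)
  have c: "length cs = Suc ?r" "cs ! 0 = bot" "\<And>i. i < ?r \<Longrightarrow> covers (cs ! Suc i) (cs ! i)"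
    using max by (auto simp: maximal_chain_iff)
  have len: "length bs = ?r" using c(1) by (simp add: bs_def length_label_sequence)
  have b: "bs ! i \<in> atoms" "bs ! i \<le> cs ! Suc i" "\<not> bs ! i \<le> cs ! i"
    "\<And>a. a \<in> atoms_below (cs ! Suc i) \<Longrightarrow> \<not> a \<le> cs ! i \<Longrightarrow> (bs ! i, a) \<in> \<omega>" if i: "i < ?r" for i
  proof -
    let ?S = "atoms_below (cs ! Suc i) - atoms_below (cs ! i)"
    have "\<not> cs ! Suc i \<le> cs ! i" using c(3)[OF i] by (auto simp: covers_def)
    then obtain a where "a \<in> atoms" "a \<le> cs ! Suc i" "\<not> a \<le> cs ! i" by (rule exists_atom_not_below)
    then have "?S \<noteq> {}" by (auto simp: atoms_below_def)
    moreover have "?S \<subseteq> atoms" by (auto simp: atoms_below_def)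
    moreover have "bs ! i = min_wrt \<omega> ?S" using i c(1) by (simp add: bs_def nth_label_sequence label_def)
    ultimately have *: "bs ! i \<in> ?S" "\<And>a. a \<in> ?S \<Longrightarrow> (bs ! i, a) \<in> \<omega>"
      using min_wrt_in_least[OF lin, of ?S] by simp_all
    then show "bs ! i \<in> atoms" "bs ! i \<le> cs ! Suc i" "\<not> bs ! i \<le> cs ! i"
      "\<And>a. a \<in> atoms_below (cs ! Suc i) \<Longrightarrow> \<not> a \<le> cs ! i \<Longrightarrow> (bs ! i, a) \<in> \<omega>"
      by (auto simp: atoms_below_def)
  qed
  have joins_eq: "joins bs ! k = cs ! k" if "k \<le> ?r" for k
    using that
  proof (induction k)
    case (Suc k)
    then show ?case using b[of k] covers_sup_eq[OF c(3)[of k], of "bs ! k"] joins_Suc[of k bs] len by simp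
  qed (simp add: c joins_0)
  show joins: "joins (label_sequence \<omega> cs) = cs"
    using joins_eq len c(1) by (intro nth_equalityI) (auto simp: length_joins bs_def[symmetric])
  have "independent (set (take k bs))" if "k \<le> ?r" for k
    using that
  proof (induction k)
    case 0
    then show ?case by (simp add: independent_def rank_bot)
  next
    case (Suc k)
    then have "set (take (Suc k) bs) = insert (bs ! k) (set (take k bs))"
      using len by (simp add: take_Suc_conv_app_nth)
    moreover have "\<not> bs ! k \<le> Sup (set (take k bs))"
      using Suc.prems b(3)[of k] joins_eq[of k] nth_joins[of k bs] len by simp
    moreover then have "bs ! k \<notin> set (take k bs)" by (auto intro: Sup_upper)
    ultimately show ?case using Suc b(1)[of k] independent_insert_iff[of "bs ! k" "set (take k bs)"] by simp
  qed
  from this[of ?r] have "independent (set bs)" using len by simp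
  moreover have "Sup (set bs) = top"
    using joins_length[of bs] joins_eq[of ?r] len maximal_chain_top[OF max] by simp
  ultimately show "basis (set (label_sequence \<omega> cs))" by (simp add: basis_iff bs_def)
  show "descending \<omega> (label_sequence \<omega> cs)" using desc by (simp add: bs_def)
  have "(bs ! k, a) \<in> \<omega>" if k: "k < ?r" and a: "a \<in> atoms_below (cs ! Suc k)" for k a
  proof -
    have "\<not> a \<le> cs ! 0" using a atom_gt_bot[of a] by (auto simp: c atoms_below_def bot_unique)
    moreover have "a \<le> cs ! Suc k" using a by (simp add: atoms_below_def)
    ultimately obtain j where j: "j < Suc k" "\<not> a \<le> cs ! j" "a \<le> cs ! Suc j"
      using ex_least_nat_less[of "\<lambda>i. a \<le> cs ! i" "Suc k"] by auto
    have "(bs ! j, a) \<in> \<omega>" using b(4)[of j a] j k a by (simp add: atoms_below_def)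
    moreover have "(bs ! k, bs ! j) \<in> \<omega>"
      using descending_nth(1)[OF desc, of j k] j(1) k len refl_wrt[OF lin b(1)[OF k]] by (cases "j = k") auto
    ultimately show ?thesis using trans_wrt[OF lin] by blast
  qed
  then show "flat_minimal \<omega> (label_sequence \<omega> cs)"
    using len joins c(1) by (simp add: flat_minimal_def bs_def)
qed

section \<open>No broken circuit bases\<close>

text \<open>An atom \<open>a\<close> that violates minimality depends on larger members of the list, so it is the minimum of
  a circuit that is otherwise contained in the list. Conversely, the minimum \<open>m\<close> of a circuit is below
  the join of the other members; if these are in the list, then \<open>m\<close> is an atom in the flat that ends at
  the smallest of them and is smaller than it.\<close>

lemma nbc_iff_flat_minimal:
  fixes \<omega> :: "'a::geometric_lattice rel"
  assumes lin: "linear_order_on atoms \<omega>" and bs: "descending \<omega> bs" "basis (set bs)"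
  shows "set bs \<in> nbc \<omega> \<longleftrightarrow> flat_minimal \<omega> bs"
proof
  have atoms: "set bs \<subseteq> atoms" and ind: "independent (set bs)" using bs(2) by (auto simp: basis_def independent_def)
  have distinct: "distinct bs" using bs(1) by (rule descending_distinct)
  {
    assume nbc: "set bs \<in> nbc \<omega>"
    show "flat_minimal \<omega> bs"
      unfolding flat_minimal_def
    proof (intro allI impI ballI)
      fix k a assume k: "k < length bs" and "a \<in> atoms_below (joins bs ! Suc k)"
      then have a: "a \<in> atoms" "a \<le> Sup (set (take (Suc k) bs))"
        by (auto simp: atoms_below_def nth_joins)
      have bk: "bs ! k \<in> atoms" using atoms nth_mem[OF k] by blast
      show "(bs ! k, a) \<in> \<omega>"
      proof (rule ccontr)
        assume "(bs ! k, a) \<notin> \<omega>"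
        then have abk: "(a, bs ! k) \<in> \<omega>" "a \<noteq> bs ! k" using total_wrt[OF lin a(1) bk] refl_wrt[OF lin bk] by auto
        define S where "S = set (take (Suc k) bs)"
        have less: "(a, b) \<in> \<omega> \<and> a \<noteq> b" if "b \<in> S" for b
        proof -
          obtain i where i: "i \<le> k" "b = bs ! i" using \<open>b \<in> S\<close> k by (auto simp: S_def in_set_conv_nth less_Suc_eq_le)
          show ?thesis
          proof (cases "i = k")
            case False
            then have "(bs ! k, b) \<in> \<omega>" using descending_nth(1)[OF bs(1), of i k] i k by simp
            then show ?thesis using abk trans_wrt[OF lin] antisym_wrt[OF lin] by blast
          qed (use abk i in simp)
        qed
        then have "a \<notin> S" by blast
        have "S \<subseteq> set bs" unfolding S_def by (rule set_take_subset)
        then have "independent S" using independent_mono[OF ind] by simp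
        have "\<not> independent (insert a S)"
          using independent_insert_iff[OF \<open>a \<notin> S\<close>] a(2) by (simp add: S_def)
        moreover have "insert a S \<subseteq> atoms" using a(1) atoms \<open>S \<subseteq> set bs\<close> by auto
        ultimately obtain C where C: "circuit C" "C \<subseteq> insert a S" by (metis contains_circuit)
        have "a \<in> C"
        proof (rule ccontr)
          assume "a \<notin> C"
          then have "C \<subseteq> S" using C(2) by auto
          then have "independent C" using independent_mono[OF \<open>independent S\<close>] by simp
          then show False using C(1) by (simp add: circuit_def)
        qed
        then have "min_wrt \<omega> C = a"
          using C(2) less refl_wrt[OF lin a(1)] by (intro min_wrt_eqI[OF lin]) auto
        then have "broken_circuit \<omega> (C - {a})" using C(1) by (auto simp: broken_circuit_def)
        moreover have "C - {a} \<subseteq> set bs" using C(2) \<open>S \<subseteq> set bs\<close> by auto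
        ultimately show False using nbc by (auto simp: nbc_def)
      qed
    qed
  }
  assume min: "flat_minimal \<omega> bs"
  have False if C: "circuit C" and sub: "C - {min_wrt \<omega> C} \<subseteq> set bs" for C
  proof -
    define m where "m = min_wrt \<omega> C"
    have "C \<subseteq> atoms" using C by (simp add: circuit_def)
    have "independent {}" by (simp add: independent_def rank_bot)
    then have "C \<noteq> {}" using C by (auto simp: circuit_def)
    then have m: "m \<in> C" "\<And>b. b \<in> C \<Longrightarrow> (m, b) \<in> \<omega>"
      using min_wrt_in_least[OF lin, of C] \<open>C \<subseteq> atoms\<close> by (auto simp: m_def)
    have le: "m \<le> Sup (C - {m})" using circuit_atom_le[OF C m(1)] .
    have "C - {m} \<noteq> {}"
    proof
      assume e: "C - {m} = {}"
      from le have "m = bot" unfolding e by (simp add: bot_unique)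
      then show False using atom_gt_bot[of m] m(1) \<open>C \<subseteq> atoms\<close> by auto
    qed
    \<comment> \<open>As the list is descending, its last entry in \<open>C\<close> is the smallest one.\<close>
    define I where "I = {i. i < length bs \<and> bs ! i \<in> C - {m}}"
    have "C - {m} = (!) bs ` I" using sub by (fastforce simp: I_def m_def in_set_conv_nth image_iff)
    then have "I \<noteq> {}" "finite I" using \<open>C - {m} \<noteq> {}\<close> by (auto simp: I_def)
    define k where "k = Max I"
    have k: "k \<in> I" "\<And>i. i \<in> I \<Longrightarrow> i \<le> k" using \<open>finite I\<close> \<open>I \<noteq> {}\<close> by (auto simp: k_def)
    then have kl: "k < length bs" "bs ! k \<in> C" "bs ! k \<noteq> m" by (auto simp: I_def)
    have "Sup (C - {m}) \<le> joins bs ! Suc k"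
      using k(2) kl(1) by (auto simp: \<open>C - {m} = (!) bs ` I\<close> le_imp_less_Suc intro!: SUP_least nth_le_joins)
    with le have "m \<le> joins bs ! Suc k" by (rule order.trans)
    then have "m \<in> atoms_below (joins bs ! Suc k)" using m(1) \<open>C \<subseteq> atoms\<close> by (auto simp: atoms_below_def)
    then have "(bs ! k, m) \<in> \<omega>" using min kl(1) by (simp add: flat_minimal_def)
    then show False using m(2)[OF kl(2)] kl(3) antisym_wrt[OF lin] by blast
  qed
  then show "set bs \<in> nbc \<omega>" using bs(2) by (auto simp: nbc_def broken_circuit_def)
qed

section \<open>Proper maximal nested sets\<close>

lemma atoms_below_nonempty:
  assumes "x \<noteq> (bot::'a::geometric_lattice)"
  shows "atoms_below x \<noteq> {}"
proof -
  have "\<not> x \<le> bot" using assms by (simp add: bot_unique)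
  then obtain a where "a \<in> atoms" "a \<le> x" by (rule exists_atom_not_below)
  then show ?thesis by (auto simp: atoms_below_def)
qed

lemma min_atom_in_least:
  fixes \<omega> :: "'a::geometric_lattice rel"
  assumes "linear_order_on atoms \<omega>" "x \<in> irreducibles"
  shows "min_atom \<omega> x \<in> atoms_below x" "a \<in> atoms_below x \<Longrightarrow> (min_atom \<omega> x, a) \<in> \<omega>"
proof -
  have "x \<noteq> bot" using assms(2) by (simp add: irreducibles_iff)
  then have "atoms_below x \<noteq> {}" by (rule atoms_below_nonempty)
  moreover have "atoms_below x \<subseteq> atoms" by (auto simp: atoms_below_def)
  ultimately show "min_atom \<omega> x \<in> atoms_below x" "a \<in> atoms_below x \<Longrightarrow> (min_atom \<omega> x, a) \<in> \<omega>"
    unfolding min_atom_def using min_wrt_in_least[OF assms(1), of "atoms_below x"] by simp_all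
qed

text \<open>The new factor of a step contains the label of that step, and this label is the minimal atom below
  the whole chain element. So it is also the minimal atom below the new factor.\<close>

lemma Theta_pn:
  fixes \<omega> :: "'a::geometric_lattice rel"
  assumes lin: "linear_order_on atoms \<omega>" and cs: "cs \<in> dc \<omega>"
  shows "Theta cs \<in> pn \<omega>" "Phi \<omega> (Theta cs) = set (label_sequence \<omega> cs)"
proof -
  let ?r = "rank (top::'a)"
  define bs where "bs = label_sequence \<omega> cs"
  have max: "maximal_chain cs" using cs by (simp add: dc_def)
  note bs = dc_joins_label_sequence[OF lin cs, folded bs_def]
  note bj = basis_distinct_joins[OF bs(2) descending_distinct[OF bs(1)], unfolded bs(4)]
  obtain s where s: "\<And>i. i < ?r \<Longrightarrow> s i \<in> factors (cs ! Suc i) \<and> \<not> s i \<le> cs ! i"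
    using new_factors_exist[OF max] by blast
  have "min_atom \<omega> (s i) = bs ! i" if i: "i < ?r" for i
  proof -
    have il: "i < length bs" using i bj(1) by simp
    have cov: "covers (cs ! Suc i) (cs ! i)" by (rule bj(2)[OF il])
    have atom: "bs ! i \<in> atoms" using bs(2) nth_mem[OF il] by (auto simp: basis_def independent_def)
    have "bs ! i \<le> cs ! Suc i" using nth_le_joins[of i "Suc i" bs] il by (simp add: bs(4))
    then obtain g where g: "g \<in> factors (cs ! Suc i)" "bs ! i \<le> g"
      by (rule irreducible_below_factor[OF atom_irreducible[OF atom]])
    have "\<not> g \<le> cs ! i" using g(2) bj(3)[OF il] by (meson order.trans)
    then have "s i = g" using covers_unique_new_factor[OF cov] s[OF i] g(1) by blast
    moreover have "(bs ! i, a) \<in> \<omega>" if "a \<in> atoms_below g" for a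
    proof -
      have "a \<in> atoms_below (cs ! Suc i)"
        using that factors_le[OF g(1)] by (auto simp: atoms_below_def intro: order.trans)
      then show ?thesis using bs(3) il by (simp add: flat_minimal_def bs(4))
    qed
    ultimately show ?thesis
      unfolding min_atom_def using g(2) atom by (intro min_wrt_eqI[OF lin]) (auto simp: atoms_below_def)
  qed
  moreover have "Theta cs = s ` {..<?r}" by (rule Theta_new_factors[OF max s])
  ultimately have "Phi \<omega> (Theta cs) = (\<lambda>i. bs ! i) ` {..<?r}"
    by (auto simp: Phi_def image_iff)
  also have "\<dots> = set bs" using bj(1) by (auto simp: set_conv_nth)
  finally show Phi: "Phi \<omega> (Theta cs) = set (label_sequence \<omega> cs)" by (simp add: bs_def)
  with bs(2) Theta_maximal_nested[OF max] show "Theta cs \<in> pn \<omega>" by (simp add: pn_def Phi_def bs_def)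
qed

text \<open>The minimal atoms of the members of \<open>S\<close> form a basis of cardinality \<open>card S\<close>, so they are distinct.
  In the chain of their descending joins, the \<open>k\<close>-th element is also the join of the down-set of those
  members of \<open>S\<close> that have the first \<open>k\<close> minimal atoms, because it is below that join and has the same
  rank. So all its factors are among these members, and each atom below it is below a factor.\<close>

lemma pn_from_dc:
  fixes \<omega> :: "'a::geometric_lattice rel"
  assumes lin: "linear_order_on atoms \<omega>" and S: "S \<in> pn \<omega>"
  shows "Psi \<omega> (Phi \<omega> S) \<in> dc \<omega>" "Theta (Psi \<omega> (Phi \<omega> S)) = S"
proof -
  let ?r = "rank (top::'a)" and ?phi = "min_atom \<omega>"
  have max: "maximal_nested S" and basis: "basis (?phi ` S)" using S by (auto simp: pn_def)
  have nested: "nested S" using max by (simp add: maximal_nested_def)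
  have irr: "x \<in> irreducibles" if "x \<in> S" for x using that nested by (auto simp: nested_def)
  note phi = min_atom_in_least[OF lin irr]
  obtain bs where bs: "descending \<omega> bs" "set bs = ?phi ` S"
    using descending_list_exists[OF lin, of "?phi ` S"] basis by (auto simp: basis_def independent_def)
  have basis_bs: "basis (set bs)" using basis bs(2) by simp
  note bj = basis_distinct_joins[OF basis_bs descending_distinct[OF bs(1)]]
  have "card S = ?r" using maximal_nested_rank[OF max, of S] maximal_nested_Sup[OF max] by simp
  also have "\<dots> = card (?phi ` S)" using basis_card[OF basis] by simp
  finally have inj: "inj_on ?phi S" by (intro eq_card_imp_inj_on) auto
  define D where "D k = {x \<in> S. ?phi x \<in> set (take k bs)}" for k
  have Sup_D: "Sup (D k) = joins bs ! k" and D_sub: "D k \<subseteq> S" if k: "k \<le> length bs" for k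
  proof -
    show "D k \<subseteq> S" by (auto simp: D_def)
    \<comment> \<open>If \<open>y\<close> is below \<open>x\<close> then its minimal atom is not smaller than that of \<open>x\<close>, so it does not
      come later in the descending list.\<close>
    have "y \<in> D k" if x: "x \<in> D k" and y: "y \<in> S" "y \<le> x" for x y
    proof -
      obtain i where i: "i < k" "?phi x = bs ! i" using x k by (auto simp: D_def in_set_conv_nth)
      have "?phi y \<in> set bs" using y(1) bs(2) by simp
      then obtain j where j: "j < length bs" "?phi y = bs ! j" by (auto simp: in_set_conv_nth)
      have "?phi y \<in> atoms_below x" using phi(1)[OF y(1)] y(2) by (auto simp: atoms_below_def intro: order.trans)
      then have "(?phi x, ?phi y) \<in> \<omega>" using phi(2) x by (auto simp: D_def)
      then have "\<not> i < j" using descending_nth[OF bs(1), of i j] i(2) j antisym_wrt[OF lin] by auto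
      then have "j < k" using i(1) by simp
      then have "?phi y \<in> set (take k bs)" using j by (auto simp: in_set_conv_nth)
      then show ?thesis using y(1) by (simp add: D_def)
    qed
    then have "rank (Sup (D k)) = card (D k)" by (intro maximal_nested_rank[OF max]) (auto simp: D_def)
    also have "\<dots> = card (?phi ` D k)" using inj by (intro card_image[symmetric]) (auto simp: D_def inj_on_def)
    also have "?phi ` D k = set (take k bs)" using bs(2) set_take_subset[of k bs] by (auto simp: D_def)
    also have "card \<dots> = k" using k descending_distinct[OF bs(1)] by (simp add: distinct_card)
    finally have "rank (Sup (D k)) = k" .
    moreover have "joins bs ! k \<le> Sup (D k)"
      unfolding nth_joins[OF k]
    proof (rule Sup_least)
      fix b assume b: "b \<in> set (take k bs)"
      then have "b \<in> ?phi ` S" using set_take_subset[of k bs] bs(2) by blast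
      then obtain x where x: "x \<in> S" "b = ?phi x" by blast
      have "b \<le> x" using phi(1)[OF x(1)] x(2) by (simp add: atoms_below_def)
      also have "x \<le> Sup (D k)" using x b by (auto simp: D_def intro: Sup_upper)
      finally show "b \<le> Sup (D k)" .
    qed
    ultimately show "Sup (D k) = joins bs ! k" using bj(5)[OF k] eq_if_le_rank[of "joins bs ! k" "Sup (D k)"] by simp
  qed
  have factors_D: "factors (joins bs ! k) \<subseteq> D k" if "k \<le> length bs" for k
    using factors_Sup_nested[OF nested_mono[OF nested D_sub[OF that]]] Sup_D[OF that] by simp
  have "flat_minimal \<omega> bs"
    unfolding flat_minimal_def
  proof (intro allI impI ballI)
    fix k a assume k: "k < length bs" and "a \<in> atoms_below (joins bs ! Suc k)"
    then have a: "a \<in> atoms" "a \<le> joins bs ! Suc k" by (auto simp: atoms_below_def)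
    obtain g where g: "g \<in> factors (joins bs ! Suc k)" "a \<le> g"
      by (rule irreducible_below_factor[OF atom_irreducible[OF a(1)] a(2)])
    then have gD: "g \<in> D (Suc k)" using factors_D[of "Suc k"] k by auto
    then obtain i where i: "i \<le> k" "?phi g = bs ! i" using k by (auto simp: D_def in_set_conv_nth less_Suc_eq_le)
    have "(?phi g, a) \<in> \<omega>" using phi(2)[of g a] gD g(2) a(1) by (auto simp: D_def atoms_below_def)
    moreover have "bs ! k \<in> atoms" using basis_bs nth_mem[OF k] by (auto simp: basis_def independent_def)
    then have "(bs ! k, ?phi g) \<in> \<omega>"
      using descending_nth(1)[OF bs(1), of i k] i k refl_wrt[OF lin] by (cases "i = k") auto
    ultimately show "(bs ! k, a) \<in> \<omega>" using trans_wrt[OF lin] by blast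
  qed
  then have dc: "joins bs \<in> dc \<omega>" by (rule joins_dc(1)[OF lin bs(1) basis_bs])
  have Psi: "Psi \<omega> (Phi \<omega> S) = joins bs" using Psi_set_descending[OF lin bs(1)] bs(2) by (simp add: Phi_def)
  with dc show "Psi \<omega> (Phi \<omega> S) \<in> dc \<omega>" by simp
  have "factors (joins bs ! Suc i) \<subseteq> S" if "i < ?r" for i
    using factors_D[of "Suc i"] D_sub[of "Suc i"] that bj(1) by auto
  then have "Theta (joins bs) \<subseteq> S" using Theta_nth[OF bj(4)] by auto
  then have "Theta (joins bs) = S"
    using Theta_maximal_nested[OF bj(4)] nested by (auto simp: maximal_nested_def)
  with Psi show "Theta (Psi \<omega> (Phi \<omega> S)) = S" by simp
qed

section \<open>The bijections\<close>

theorem proposition4p2: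
  fixes \<omega> :: "'a::geometric_lattice rel"
  assumes "rank (top :: 'a) \<ge> 1"
    and "linear_order_on (atoms :: 'a set) \<omega>"
  shows "bij_betw (Psi \<omega>) (nbc \<omega>) (dc \<omega>) \<and>
    bij_betw Theta (dc \<omega>) (pn \<omega>) \<and>
    bij_betw (Phi \<omega>) (pn \<omega>) (nbc \<omega>)"
proof -
  note lin = assms(2)
  define labels where "labels cs = set (label_sequence \<omega> cs)" for cs
  have nbc: "Psi \<omega> B \<in> dc \<omega>" "labels (Psi \<omega> B) = B" if B: "B \<in> nbc \<omega>" for B
  proof -
    have basis: "basis B" using B by (simp add: nbc_def)
    then have "B \<subseteq> atoms" by (simp add: basis_def independent_def)
    then obtain bs where bs: "descending \<omega> bs" "set bs = B"
      using descending_list_exists[OF lin, of B] by auto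
    then have "flat_minimal \<omega> bs" using nbc_iff_flat_minimal[OF lin bs(1)] B basis by simp
    then have "joins bs \<in> dc \<omega>" "label_sequence \<omega> (joins bs) = bs"
      using joins_dc[OF lin bs(1)] bs(2) basis by auto
    then show "Psi \<omega> B \<in> dc \<omega>" "labels (Psi \<omega> B) = B"
      using Psi_set_descending[OF lin bs(1)] bs(2) by (auto simp: labels_def)
  qed
  have dc: "labels cs \<in> nbc \<omega>" "Psi \<omega> (labels cs) = cs" "Theta cs \<in> pn \<omega>" "Phi \<omega> (Theta cs) = labels cs"
    if cs: "cs \<in> dc \<omega>" for cs
  proof -
    note bs = dc_joins_label_sequence[OF lin cs]
    show "labels cs \<in> nbc \<omega>"
      unfolding labels_def using nbc_iff_flat_minimal[OF lin bs(1,2)] bs(3) by simp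
    show "Psi \<omega> (labels cs) = cs"
      unfolding labels_def using Psi_set_descending[OF lin bs(1)] bs(4) by simp
    show "Theta cs \<in> pn \<omega>" "Phi \<omega> (Theta cs) = labels cs"
      using Theta_pn[OF lin cs] by (simp_all add: labels_def)
  qed
  note pn = pn_from_dc[OF lin]
  have "bij_betw (Psi \<omega>) (nbc \<omega>) (dc \<omega>)"
    by (rule bij_betw_byWitness[where f' = labels]) (use nbc dc in auto)
  moreover have "bij_betw Theta (dc \<omega>) (pn \<omega>)"
    by (rule bij_betw_byWitness[where f' = "\<lambda>S. Psi \<omega> (Phi \<omega> S)"]) (use dc pn in auto)
  moreover have "Phi \<omega> S \<in> nbc \<omega>" if "S \<in> pn \<omega>" for S
    using dc(1,4)[OF pn(1)[OF that]] pn(2)[OF that] by simp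
  then have "bij_betw (Phi \<omega>) (pn \<omega>) (nbc \<omega>)"
    by (intro bij_betw_byWitness[where f' = "\<lambda>B. Theta (Psi \<omega> B)"]) (use dc nbc pn in auto)
  ultimately show ?thesis by simp
qed

end
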